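(* Let $G=(V,E)$ be a graph with $n$ vertices and $m$ edges, and let $k=O(\operatorname{polylog} n)$. Executing Stage I followed by Stage II (described in the context) produces a culled balanced partition $(C,\{V_1,\dots,V_k\})$ of $G$ of size $k$, using linear work with high probability and polylogarithmic span.
   Context: A culled balanced partition of size $k$ of $G$ is a tuple $(C,\{V_1,\dots,V_k\})$ where $C\subseteq V$ has size $O(\operatorname{polylog} n)$ and $\{V_1,\dots,V_k\}$ is a partition of $V\setminus C$ such that each induced subgraph $G[V_i]$ has $O(m/k^2)$ edges. Stage I (culling): initialize $C=\emptyset$ and $H\gets G$. Repeat phases: for the current graph $H$ with $e(H)$ edges and maximum degree $\Delta(H)$, let $\tau(H):=e(H)/(k^4\log n)$; if $\Delta(H)>\tau(H)$, remove in parallel all vertices $v$ with $\deg_H(v)>\tau(H)/2$ from $H$ and add them to $C$; otherwise stop, and set $G':=G[V\setminus C]$. Stage II: assign each vertex of $V\setminus C$ independently and uniformly at random to one of $k$ buckets, producing $V\setminus C=V_1\sqcup\cdots\sqcup V_k$, and output $(C,\{V_1,\dots,V_k\})$. Work/span refer to the work-depth model (work = total operations, span = longest chain of dependent operations). "With high probability" means with probability $1-n^{-\Omega(1)}$. *)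

theory Defs
  imports
    "HOL-Probability.Probability"
    "HOL-Library.While_Combinator"
    "HOL-Library.Monad_Syntax"
begin

section \<open>Graphs and culled balanced partitions\<close>

type_synonym 'a graph = "'a set \<times> 'a set set"

abbreviation verts :: "'a graph \<Rightarrow> 'a set" where "verts \<equiv> fst"
abbreviation edges :: "'a graph \<Rightarrow> 'a set set" where "edges \<equiv> snd"

definition simple_graph :: "'a graph \<Rightarrow> bool" where
  "simple_graph G \<longleftrightarrow> finite (verts G) \<and> (\<forall>e\<in>edges G. e \<subseteq> verts G \<and> card e = 2)"

definition induced :: "'a graph \<Rightarrow> 'a set \<Rightarrow> 'a graph" where
  "induced G U = (verts G \<inter> U, {e \<in> edges G. e \<subseteq> U})"

definition deg :: "'a graph \<Rightarrow> 'a \<Rightarrow> nat" where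
  "deg G v = card {e \<in> edges G. v \<in> e}"

text \<open>The inserted 0 only matters for the graph without vertices.\<close>
definition max_deg :: "'a graph \<Rightarrow> nat" where
  "max_deg G = Max (insert 0 (deg G ` verts G))"

text \<open>\<open>(C, [V\<^sub>1, \<dots>, V\<^sub>k])\<close> is a culled balanced partition, where
  \<open>B * (log n) ^ b\<close> is the bound hidden in \<open>|C| = O(polylog n)\<close> and \<open>K\<close> the constant hidden in
  \<open>O(m / k\<^sup>2)\<close>. Parts of the partition may be empty.\<close>
definition culled_balanced_partition ::
  "real \<Rightarrow> nat \<Rightarrow> real \<Rightarrow> 'a graph \<Rightarrow> nat \<Rightarrow> 'a set \<times> 'a set list \<Rightarrow> bool" where
  "culled_balanced_partition B b K G k = (\<lambda>(C, Vs).
     C \<subseteq> verts G \<and>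
     real (card C) \<le> B * log 2 (card (verts G)) ^ b \<and>
     length Vs = k \<and>
     (\<Union>i<k. Vs ! i) = verts G - C \<and>
     disjoint_family_on (\<lambda>i. Vs ! i) {..<k} \<and>
     (\<forall>i<k. real (card (edges (induced G (Vs ! i)))) \<le> K * (card (edges G) / k\<^sup>2)))"

section \<open>The two stages\<close>

definition tau :: "nat \<Rightarrow> nat \<Rightarrow> 'a graph \<Rightarrow> real" where
  "tau n k H = card (edges H) / (real k ^ 4 * log 2 n)"

definition heavy :: "nat \<Rightarrow> nat \<Rightarrow> 'a graph \<Rightarrow> 'a set" where
  "heavy n k H = {v \<in> verts H. deg H v > tau n k H / 2}"

definition stage_I :: "'a graph \<Rightarrow> nat \<Rightarrow> 'a set" where
  "stage_I G k = (let n = card (verts G) in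
     fst (while (\<lambda>(C, H). max_deg H > tau n k H)
            (\<lambda>(C, H). (C \<union> heavy n k H, induced H (verts H - heavy n k H)))
            ({}, G)))"

definition stage_II :: "'a graph \<Rightarrow> nat \<Rightarrow> 'a set \<Rightarrow> ('a set \<times> 'a set list) pmf" where
  "stage_II G k C =
     map_pmf (\<lambda>\<omega>. (C, map (\<lambda>i. {v \<in> verts G - C. \<omega> v = i}) [0..<k]))
       (Pi_pmf (verts G - C) 0 (\<lambda>_. pmf_of_set {..<k}))"

definition stages :: "'a graph \<Rightarrow> nat \<Rightarrow> ('a set \<times> 'a set list) pmf" where
  "stages G k = stage_II G k (stage_I G k)"

section \<open>Work and span\<close>

text \<open>A binary fork-join cost model. \<open>cbind\<close> is sequential composition, \<open>fork\<close> parallel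
  composition, and \<open>unit_op\<close> a single machine operation: arithmetic or a comparison on numbers
  (including the evaluation of \<open>log\<close>), a memory access, taking a subrange of an array, drawing a
  uniform bucket index, or allocating one cell of a data structure. \<open>ret\<close> only passes on values that
  have already been computed.\<close>

datatype 'a costed = Costed (result: 'a) (work: nat) (cspan: nat)

definition ret :: "'a \<Rightarrow> 'a costed" where
  "ret x = Costed x 0 0"

definition unit_op :: "'a \<Rightarrow> 'a costed" where
  "unit_op x = Costed x 1 1"

definition cbind :: "'a costed \<Rightarrow> ('a \<Rightarrow> 'b costed) \<Rightarrow> 'b costed" where
  "cbind c f = (let d = f (result c) in
     Costed (result d) (work c + work d) (cspan c + cspan d))"

adhoc_overloading Monad_Syntax.bind \<rightleftharpoons> cbind

definition fork :: "'a costed \<Rightarrow> 'b costed \<Rightarrow> ('a \<times> 'b) costed" where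
  "fork c d = Costed (result c, result d) (1 + work c + work d) (1 + max (cspan c) (cspan d))"

text \<open>Iterates \<open>f\<close> from \<open>s\<close> until it returns a value of the form \<^term>\<open>Inr r\<close>.\<close>
definition cloop :: "('s \<Rightarrow> ('s + 'r) costed) \<Rightarrow> 's \<Rightarrow> 'r costed" where
  "cloop f s = (let (x, w, d) =
       while (\<lambda>(x, w, d). isl x)
         (\<lambda>(x, w, d). let c = f (projl x) in (result c, w + work c, d + cspan c))
         (Inl s, 0, 0)
     in Costed (projr x) w d)"

text \<open>Sequences are binary trees, so that concatenation is a single operation and all bulk
  operations are fork-join recursions over the tree. Dropping empty subtrees in \<open>sjoin\<close> keeps the
  size of a tree linear in its number of elements.\<close>

datatype 'a seq = SEmpty | SOne 'a | SCat "'a seq" "'a seq"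

fun sjoin :: "'a seq \<Rightarrow> 'a seq \<Rightarrow> 'a seq" where
  "sjoin SEmpty t = t"
| "sjoin s SEmpty = s"
| "sjoin s t = SCat s t"

text \<open>The combining function \<open>g\<close> must be a constant-time operation.\<close>
fun mapreduce :: "('b \<Rightarrow> 'b \<Rightarrow> 'b) \<Rightarrow> 'b \<Rightarrow> ('a \<Rightarrow> 'b costed) \<Rightarrow> 'a seq \<Rightarrow> 'b costed" where
  "mapreduce g z f SEmpty = unit_op z"
| "mapreduce g z f (SOne x) = f x"
| "mapreduce g z f (SCat l r) = do {
     (a, b) \<leftarrow> fork (mapreduce g z f l) (mapreduce g z f r);
     unit_op (g a b) }"

definition scount :: "'a seq \<Rightarrow> nat costed" where
  "scount = mapreduce (+) 0 (\<lambda>_. unit_op 1)"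

definition smap :: "('a \<Rightarrow> 'b costed) \<Rightarrow> 'a seq \<Rightarrow> 'b seq costed" where
  "smap f = mapreduce SCat SEmpty (\<lambda>x. do { y \<leftarrow> f x; unit_op (SOne y) })"

definition sfilter :: "('a \<Rightarrow> bool costed) \<Rightarrow> 'a seq \<Rightarrow> 'a seq costed" where
  "sfilter p = mapreduce sjoin SEmpty
     (\<lambda>x. do { b \<leftarrow> p x; unit_op (if b then SOne x else SEmpty) })"

text \<open>Input arrays are lists, and \<^term>\<open>take h xs\<close>, \<^term>\<open>drop h xs\<close> stand for index ranges.\<close>
function of_array :: "'a list \<Rightarrow> 'a seq costed" where
  "of_array xs =
     (if xs = [] then unit_op SEmpty
      else if length xs = 1 then unit_op (SOne (xs ! 0))
      else let h = length xs div 2 in do {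
        (l, r) \<leftarrow> fork (of_array (take h xs)) (of_array (drop h xs));
        unit_op (SCat l r) })"
  by pat_completeness auto
termination
  by (relation "Wellfounded.measure length") (auto simp: neq_Nil_conv)

declare of_array.simps [simp del]

text \<open>Parallel writes to a memory indexed by vertices. It is only applied to sequences with pairwise
  distinct addresses, for which the order of the writes is irrelevant.\<close>
fun par_write :: "('a \<Rightarrow> 'b) \<Rightarrow> ('a \<times> 'b) seq \<Rightarrow> ('a \<Rightarrow> 'b) costed" where
  "par_write M SEmpty = unit_op M"
| "par_write M (SOne (v, x)) = unit_op (M(v := x))"
| "par_write M (SCat l r) =
     (let c = par_write M l; d = par_write (result c) r in
      Costed (result d) (1 + work c + work d) (1 + max (cspan c) (cspan d)))"

section \<open>Implementation of the stages with cost accounting\<close>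

text \<open>The input: the array of the vertices and, for every vertex, the array of its neighbours.\<close>
definition adjacency_arrays :: "'a graph \<Rightarrow> 'a list \<Rightarrow> ('a \<Rightarrow> 'a list) \<Rightarrow> bool" where
  "adjacency_arrays G vs adj \<longleftrightarrow>
     distinct vs \<and> set vs = verts G \<and>
     (\<forall>v\<in>verts G. distinct (adj v) \<and> set (adj v) = {u. {v, u} \<in> edges G})"

text \<open>One phase of the culling. The state consists of the current graph \<open>H\<close> as a sequence of vertices
  with their neighbours, the memory \<open>F\<close> of flags marking the culled vertices, and the sequence \<open>C\<close> of
  culled vertices; \<open>q\<close> is \<open>k\<^sup>4 log n\<close>. Vertices that have become isolated are dropped from \<open>H\<close>: they
  have no influence on \<open>e(H)\<close> and \<open>\<Delta>(H)\<close> and are never culled later.\<close>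
definition phase_c :: "real \<Rightarrow> ('a \<times> 'a seq) seq \<times> ('a \<Rightarrow> bool) \<times> 'a seq \<Rightarrow>
    ((('a \<times> 'a seq) seq \<times> ('a \<Rightarrow> bool) \<times> 'a seq) + (('a \<Rightarrow> bool) \<times> 'a seq)) costed" where
  "phase_c q = (\<lambda>(H, F, C). do {
     D \<leftarrow> smap (\<lambda>(v, A). do { d \<leftarrow> scount A; unit_op (v, d, A) }) H;
     s \<leftarrow> mapreduce (+) 0 (\<lambda>(v, d, A). unit_op d) D;
     \<Delta> \<leftarrow> mapreduce max 0 (\<lambda>(v, d, A). unit_op d) D;
     e \<leftarrow> unit_op (real s / 2);
     \<tau> \<leftarrow> unit_op (e / q);
     \<tau>2 \<leftarrow> unit_op (\<tau> / 2);
     continue \<leftarrow> unit_op (real \<Delta> > \<tau>);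
     if \<not> continue then ret (Inr (F, C))
     else do {
       W \<leftarrow> smap (\<lambda>(v, d, A). unit_op (v, real d > \<tau>2)) D;
       F' \<leftarrow> par_write F W;
       X \<leftarrow> mapreduce sjoin SEmpty (\<lambda>(v, h). unit_op (if h then SOne v else SEmpty)) W;
       C' \<leftarrow> unit_op (sjoin C X);
       H' \<leftarrow> mapreduce sjoin SEmpty
         (\<lambda>(v, d, A). do {
            h \<leftarrow> unit_op (F' v);
            if h then unit_op SEmpty
            else do {
              A' \<leftarrow> sfilter (\<lambda>u. do { b \<leftarrow> unit_op (F' u); unit_op (\<not> b) }) A;
              unit_op (if A' = SEmpty then SEmpty else SOne (v, A')) } }) D;
       ret (Inl (H', F', C')) } })"

definition stage_I_c :: "'a list \<Rightarrow> ('a \<Rightarrow> 'a list) \<Rightarrow> nat \<Rightarrow> (('a \<Rightarrow> bool) \<times> 'a seq) costed" where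
  "stage_I_c vs adj k = do {
     T \<leftarrow> of_array vs;
     n \<leftarrow> scount T;
     k2 \<leftarrow> unit_op (real k * real k);
     k4 \<leftarrow> unit_op (k2 * k2);
     l \<leftarrow> unit_op (log 2 (real n));
     q \<leftarrow> unit_op (k4 * l);
     Z \<leftarrow> smap (\<lambda>v. unit_op (v, False)) T;
     F \<leftarrow> par_write (\<lambda>_. undefined) Z;
     H \<leftarrow> smap (\<lambda>v. do { A \<leftarrow> of_array (adj v); unit_op (v, A) }) T;
     cloop (phase_c q) (H, F, SEmpty) }"

text \<open>Distributing the vertices to an array of \<open>k\<close> buckets: blocks of at most \<open>k\<close> vertices are
  processed sequentially, and the bucket arrays of the blocks are merged along a binary tree.
  Evaluating \<open>\<omega> v\<close> is the random draw for the vertex \<open>v\<close>, performed at most once per vertex.\<close>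

fun fill :: "nat \<Rightarrow> 'a seq list costed" where
  "fill 0 = unit_op []"
| "fill (Suc k) = do { B \<leftarrow> fill k; unit_op (SEmpty # B) }"

fun insert_block :: "('a \<Rightarrow> bool) \<Rightarrow> ('a \<Rightarrow> nat) \<Rightarrow> 'a list \<Rightarrow> 'a seq list \<Rightarrow> 'a seq list costed" where
  "insert_block F \<omega> [] B = unit_op B"
| "insert_block F \<omega> (v # vs) B = do {
     h \<leftarrow> unit_op (F v);
     B' \<leftarrow> (if h then unit_op B
           else do {
             i \<leftarrow> unit_op (\<omega> v);
             b \<leftarrow> unit_op (B ! i);
             b' \<leftarrow> unit_op (sjoin b (SOne v));
             unit_op (B[i := b']) });
     insert_block F \<omega> vs B' }"

fun merge_buckets :: "'a seq list \<Rightarrow> 'a seq list \<Rightarrow> 'a seq list costed" where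
  "merge_buckets (s # B) (t # B') = do {
     u \<leftarrow> unit_op (sjoin s t);
     B'' \<leftarrow> merge_buckets B B';
     unit_op (u # B'') }"
| "merge_buckets _ _ = unit_op []"

function distribute :: "('a \<Rightarrow> bool) \<Rightarrow> ('a \<Rightarrow> nat) \<Rightarrow> nat \<Rightarrow> 'a list \<Rightarrow> 'a seq list costed" where
  "distribute F \<omega> k xs =
     (if length xs \<le> max 1 k then do { B \<leftarrow> fill k; insert_block F \<omega> xs B }
      else let h = length xs div 2 in do {
        (B, B') \<leftarrow> fork (distribute F \<omega> k (take h xs)) (distribute F \<omega> k (drop h xs));
        merge_buckets B B' })"
  by pat_completeness auto
termination
  by (relation "Wellfounded.measure (\<lambda>(F, \<omega>, k, xs). length xs)") auto

declare distribute.simps [simp del]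

definition stages_c ::
  "'a list \<Rightarrow> ('a \<Rightarrow> 'a list) \<Rightarrow> nat \<Rightarrow> ('a seq \<times> 'a seq list) costed pmf" where
  "stages_c vs adj k = (let c = stage_I_c vs adj k; (F, C) = result c in
     map_pmf
       (\<lambda>\<omega>. do { (F, C) \<leftarrow> c; B \<leftarrow> distribute F \<omega> k vs; ret (C, B) })
       (Pi_pmf {v \<in> set vs. \<not> F v} 0 (\<lambda>_. pmf_of_set {..<k})))"

definition run_output :: "('a seq \<times> 'a seq list) costed \<Rightarrow> 'a set \<times> 'a set list" where
  "run_output r = (case result r of (C, B) \<Rightarrow> (set_seq C, map set_seq B))"

end

theory Submission
  imports Defs
begin

text \<open>
  Culling: a phase removes all vertices of degree above \<open>\<tau>/2\<close>, and the next phase only runs if some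
  remaining degree exceeds the new threshold. So two consecutive thresholds, and with them the numbers
  of edges, differ by a factor of more than 2. This gives \<open>O(log n)\<close> phases with geometrically
  decreasing work, and each phase culls at most \<open>4 k\<^sup>4 log n\<close> vertices because the degrees add up to
  \<open>2e\<close>.

  Bucketing: once \<open>\<Delta> \<le> e / (k\<^sup>4 log n)\<close>, moving one vertex \<open>v\<close> changes the number of edges inside a
  bucket by at most \<open>deg v\<close>, and \<open>\<Sum> (deg v)\<^sup>2 \<le> 2 e \<Delta> \<le> 2 e\<^sup>2 / (k\<^sup>4 log n)\<close>. By McDiarmid's inequality a
  deviation of \<open>r e / k\<^sup>2\<close> from the mean \<open>e / k\<^sup>2\<close> has probability at most \<open>exp (- r\<^sup>2 log n)\<close>, which
  beats the union bound over the \<open>k\<close> buckets for a large constant \<open>r\<close>.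
\<close>

section \<open>McDiarmid's inequality\<close>

text \<open>The test uses \<open>\<tau>\<close>, the cull \<open>\<tau> / 2\<close>: this gap is
  what makes a further phase imply a halving, but the halving becomes visible only one phase later,
  so the loop bounds need a case distinction.

  A shrinking number of edges yields shrinking work only if a phase costs O(e) instead of O(n).
  Therefore a vertex whose neighbour sequence becomes empty leaves the state, and every remaining
  vertex is paid for by an incident edge. Filtering never deepens a tree, so a single depth bound of
  order log n serves all phases without rebalancing.

  Two edges sharing an endpoint do not fall into a given bucket independently, so bounds for sums of
  independent indicators do not apply. The independent choices are those of the vertices, hence
  bounded differences. The factor k^4 in the threshold is what cancels the k^4 coming from the
  squared deviation.

  The buckets are k separate accumulators, so merging them costs about k; blocks of about k vertices
  keep the total linear. Work and span bounds hold for every outcome; the only random failure is an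
  overfull bucket.\<close>

lemma expectation_pair_pmf_finite:
  fixes f :: "'a \<times> 'b \<Rightarrow> real"
  assumes "finite (set_pmf p)" "finite (set_pmf q)"
  shows "measure_pmf.expectation (pair_pmf p q) f =
    measure_pmf.expectation q (\<lambda>b. measure_pmf.expectation p (\<lambda>a. f (a, b)))"
proof -
  have "measure_pmf.expectation (pair_pmf p q) f =
      (\<Sum>x\<in>set_pmf p \<times> set_pmf q. f x * pmf (pair_pmf p q) x)"
    using assms by (intro integral_measure_pmf_real) auto
  also have "\<dots> = (\<Sum>a\<in>set_pmf p. \<Sum>b\<in>set_pmf q. f (a, b) * (pmf p a * pmf q b))"
    by (auto simp: sum.cartesian_product pmf_pair intro!: sum.cong)
  also have "\<dots> = (\<Sum>b\<in>set_pmf q. \<Sum>a\<in>set_pmf p. f (a, b) * (pmf p a * pmf q b))"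
    by (rule sum.swap)
  also have "\<dots> = (\<Sum>b\<in>set_pmf q. (\<Sum>a\<in>set_pmf p. f (a, b) * pmf p a) * pmf q b)"
    by (simp add: sum_distrib_right mult.assoc)
  also have "\<dots> = (\<Sum>b\<in>set_pmf q. measure_pmf.expectation p (\<lambda>a. f (a, b)) * pmf q b)"
    using assms by (intro sum.cong refl arg_cong2[where f = "(*)"] integral_measure_pmf_real[symmetric]) auto
  also have "\<dots> = measure_pmf.expectation q (\<lambda>b. measure_pmf.expectation p (\<lambda>a. f (a, b)))"
    using assms by (intro integral_measure_pmf_real[symmetric]) auto
  finally show ?thesis .
qed

text \<open>Bounded differences supply no interval in advance. On a finite support the minimum and
  maximum of \<open>X\<close> span one, and its length is itself such a difference.\<close>

lemma hoeffding_lemma_pmf: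
  fixes X :: "'a \<Rightarrow> real"
  assumes fin: "finite (set_pmf p)" and s: "s > 0"
    and mean: "measure_pmf.expectation p X = 0"
    and diff: "\<And>y z. y \<in> set_pmf p \<Longrightarrow> z \<in> set_pmf p \<Longrightarrow> X y - X z \<le> c"
  shows "measure_pmf.expectation p (\<lambda>y. exp (s * X y)) \<le> exp (s\<^sup>2 * c\<^sup>2 / 8)"
proof -
  let ?l = "Min (X ` set_pmf p)" and ?u = "Max (X ` set_pmf p)"
  have fin': "finite (X ` set_pmf p)" and ne: "X ` set_pmf p \<noteq> {}"
    using fin by (auto simp: set_pmf_not_empty)
  interpret interval_bounded_random_variable "measure_pmf p" X ?l ?u
    by unfold_locales (use fin' in \<open>auto simp: AE_measure_pmf_iff\<close>)
  have "ennreal (measure_pmf.expectation p (\<lambda>y. exp (s * X y))) =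
      nn_integral (measure_pmf p) (\<lambda>y. exp (s * X y))"
    by (intro nn_integral_eq_integral[symmetric] integrable_measure_pmf_finite fin) auto
  also have "\<dots> \<le> ennreal (exp (s\<^sup>2 * (?u - ?l)\<^sup>2 / 8))"
    by (rule Hoeffdings_lemma_nn_integral_0[OF s mean])
  finally have "measure_pmf.expectation p (\<lambda>y. exp (s * X y)) \<le> exp (s\<^sup>2 * (?u - ?l)\<^sup>2 / 8)"
    by simp
  also have "\<dots> \<le> exp (s\<^sup>2 * c\<^sup>2 / 8)"
  proof -
    have "?u \<in> X ` set_pmf p" "?l \<in> X ` set_pmf p"
      using fin' ne by (auto intro: Max_in Min_in)
    then have "?u - ?l \<le> c"
      using diff by auto
    moreover have "?l \<le> ?u"
      using fin' ne by (meson Max_ge Min_in)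
    ultimately show ?thesis
      by (auto intro!: divide_right_mono mult_left_mono power_mono)
  qed
  finally show ?thesis .
qed

lemma finite_set_Pi_pmf:
  assumes "finite A" "\<And>v. finite (set_pmf (p v))"
  shows "finite (set_pmf (Pi_pmf A dflt p))"
  using assms by (auto simp: set_Pi_pmf intro!: finite_PiE_dflt)

text \<open>Averaging out one coordinate replaces the martingale: \<open>g\<close> is the
  conditional expectation of \<open>f\<close> given the other coordinates, has the same mean and
  inherits their difference bounds. With the others fixed, \<open>f - g\<close> is centred and
  varies by at most \<open>c v\<close>, so Hoeffding's lemma gives one factor and the induction
  hypothesis for \<open>g\<close> the rest.\<close>

lemma bounded_differences_mgf:
  fixes f :: "('a \<Rightarrow> 'b) \<Rightarrow> real"
  assumes "finite A" and s: "s > 0" and fin: "\<And>v. finite (set_pmf (p v))"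
    and "\<And>v x y z. v \<in> A \<Longrightarrow> f (x(v := y)) - f (x(v := z)) \<le> c v"
  shows "measure_pmf.expectation (Pi_pmf A dflt p)
      (\<lambda>x. exp (s * (f x - measure_pmf.expectation (Pi_pmf A dflt p) f)))
    \<le> exp (s\<^sup>2 * (\<Sum>v\<in>A. (c v)\<^sup>2) / 8)"
  using assms(1,4)
proof (induction A arbitrary: f rule: finite_induct)
  case empty
  then show ?case by simp
next
  case (insert v A)
  define P where "P = Pi_pmf A dflt p"
  define g where "g = (\<lambda>x. measure_pmf.expectation (p v) (\<lambda>y. f (x(v := y))))"
  have finP: "finite (set_pmf P)"
    unfolding P_def using insert.hyps fin by (intro finite_set_Pi_pmf)
  have E: "measure_pmf.expectation (Pi_pmf (insert v A) dflt p) h =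
      measure_pmf.expectation P (\<lambda>x. measure_pmf.expectation (p v) (\<lambda>y. h (x(v := y))))"
    for h :: "('a \<Rightarrow> 'b) \<Rightarrow> real"
    using insert.hyps by (simp add: Pi_pmf_insert expectation_pair_pmf_finite fin finP[unfolded P_def] P_def)
  have int: "integrable (measure_pmf (p v)) h" for h :: "'b \<Rightarrow> real"
    by (intro integrable_measure_pmf_finite fin)
  have intP: "integrable (measure_pmf P) h" for h :: "('a \<Rightarrow> 'b) \<Rightarrow> real"
    by (intro integrable_measure_pmf_finite finP)
  define \<mu> where "\<mu> = measure_pmf.expectation P g"
  have \<mu>: "measure_pmf.expectation (Pi_pmf (insert v A) dflt p) f = \<mu>"
    by (simp add: E \<mu>_def g_def)
  \<comment> \<open>Updates at distinct coordinates commute, so the bound for \<open>u\<close> holds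
    for each value of coordinate \<open>v\<close> and survives the average.\<close>
  have g_diff: "g (x(u := y)) - g (x(u := z)) \<le> c u" if "u \<in> A" for u x y z
  proof -
    have uv: "u \<noteq> v" using that insert.hyps by auto
    have "g (x(u := y)) - g (x(u := z)) =
        measure_pmf.expectation (p v) (\<lambda>w. f (x(u := y, v := w)) - f (x(u := z, v := w)))"
      unfolding g_def by (intro Bochner_Integration.integral_diff[symmetric] int)
    also have "\<dots> \<le> measure_pmf.expectation (p v) (\<lambda>w. c u)"
    proof (intro integral_mono int)
      fix w
      show "f (x(u := y, v := w)) - f (x(u := z, v := w)) \<le> c u"
        using insert.prems[of u "x(v := w)" y z] that by (simp only: fun_upd_twist[OF uv]) (simp add: fun_upd_def)
    qed
    finally show ?thesis by simp
  qed
  have "measure_pmf.expectation (Pi_pmf (insert v A) dflt p) (\<lambda>x. exp (s * (f x - \<mu>))) =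
     measure_pmf.expectation P (\<lambda>x. exp (s * (g x - \<mu>)) *
       measure_pmf.expectation (p v) (\<lambda>y. exp (s * (f (x(v := y)) - g x))))"
    unfolding E
    by (intro Bochner_Integration.integral_cong refl)
      (simp add: exp_add[symmetric] algebra_simps flip: integral_mult_right_zero)
  also have "\<dots> \<le> measure_pmf.expectation P (\<lambda>x. exp (s * (g x - \<mu>)) * exp (s\<^sup>2 * (c v)\<^sup>2 / 8))"
  proof (intro integral_mono intP mult_left_mono hoeffding_lemma_pmf fin s)
    fix x y z
    show "measure_pmf.expectation (p v) (\<lambda>y. f (x(v := y)) - g x) = 0"
      using int by (simp add: g_def)
    show "f (x(v := y)) - g x - (f (x(v := z)) - g x) \<le> c v"
      using insert.prems[of v x y z] by (simp add: fun_upd_def)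
  qed auto
  also have "\<dots> = measure_pmf.expectation P (\<lambda>x. exp (s * (g x - \<mu>))) * exp (s\<^sup>2 * (c v)\<^sup>2 / 8)"
    by simp
  also have "\<dots> \<le> exp (s\<^sup>2 * (\<Sum>v\<in>A. (c v)\<^sup>2) / 8) * exp (s\<^sup>2 * (c v)\<^sup>2 / 8)"
    using insert.IH[of g] g_diff unfolding P_def \<mu>_def by (intro mult_right_mono) (auto simp: fun_upd_def)
  also have "\<dots> = exp (s\<^sup>2 * (\<Sum>v\<in>insert v A. (c v)\<^sup>2) / 8)"
    using insert.hyps by (simp add: exp_add[symmetric] algebra_simps add_divide_distrib)
  finally show ?case by (simp add: \<mu>)
qed

theorem mcdiarmid_inequality:
  fixes f :: "('a \<Rightarrow> 'b) \<Rightarrow> real" and dflt :: 'b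
  assumes A: "finite A" and t: "t > 0" and fin: "\<And>v. finite (set_pmf (p v))"
    and diff: "\<And>v x y z. v \<in> A \<Longrightarrow> f (x(v := y)) - f (x(v := z)) \<le> c v"
    and V: "(\<Sum>v\<in>A. (c v)\<^sup>2) \<le> V" "V > 0"
  defines "P \<equiv> Pi_pmf A dflt p"
  shows "measure_pmf.prob P {x. f x \<ge> measure_pmf.expectation P f + t} \<le> exp (- 2 * t\<^sup>2 / V)"
proof -
  define \<mu> where "\<mu> = measure_pmf.expectation P f"
  \<comment> \<open>Minimises the exponent \<open>- s * t + s^2 * V / 8\<close>. A positive upper
    bound \<open>V\<close> in place of the sum keeps the quotient meaningful when all
    \<open>c v\<close> vanish.\<close>
  define s where "s = 4 * t / V"
  have s: "s > 0" using t V by (simp add: s_def)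
  have finP: "finite (set_pmf P)"
    unfolding P_def using A fin by (intro finite_set_Pi_pmf)
  have "measure_pmf.prob P {x. f x \<ge> \<mu> + t} = measure_pmf.expectation P (indicator {x. f x \<ge> \<mu> + t})"
    by simp
  also have "\<dots> \<le> measure_pmf.expectation P (\<lambda>x. exp (- s * t) * exp (s * (f x - \<mu>)))"
  proof (intro integral_mono integrable_measure_pmf_finite finP)
    fix x
    have "1 \<le> exp (- s * t) * exp (s * (f x - \<mu>))" if "f x \<ge> \<mu> + t"
    proof -
      have "0 \<le> s * (f x - \<mu> - t)" using that s by auto
      then show ?thesis by (simp add: exp_add[symmetric] algebra_simps)
    qed
    then show "indicator {x. f x \<ge> \<mu> + t} x \<le> exp (- s * t) * exp (s * (f x - \<mu>))"
      by (auto simp: indicator_def)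
  qed
  also have "\<dots> = exp (- s * t) * measure_pmf.expectation P (\<lambda>x. exp (s * (f x - \<mu>)))"
    by simp
  also have "\<dots> \<le> exp (- s * t) * exp (s\<^sup>2 * (\<Sum>v\<in>A. (c v)\<^sup>2) / 8)"
    using bounded_differences_mgf[of A s p f c dflt] A s fin diff
    unfolding P_def \<mu>_def by (intro mult_left_mono) auto
  also have "\<dots> \<le> exp (- s * t) * exp (s\<^sup>2 * V / 8)"
    using V by (auto intro!: mult_left_mono divide_right_mono)
  also have "\<dots> = exp (- 2 * t\<^sup>2 / V)"
    using V by (simp add: exp_add[symmetric] s_def field_simps power2_eq_square)
  finally show ?thesis by (simp add: \<mu>_def)
qed

section \<open>Costs of bulk operations on sequences\<close>

lemma costed_ret [simp]:
  "result (ret x) = x" "work (ret x) = 0" "cspan (ret x) = 0"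
  by (simp_all add: ret_def)

lemma costed_unit_op [simp]:
  "result (unit_op x) = x" "work (unit_op x) = 1" "cspan (unit_op x) = 1"
  by (simp_all add: unit_op_def)

lemma costed_cbind [simp]:
  "result (cbind c f) = result (f (result c))"
  "work (cbind c f) = work c + work (f (result c))"
  "cspan (cbind c f) = cspan c + cspan (f (result c))"
  by (simp_all add: cbind_def Let_def)

lemma costed_fork [simp]:
  "result (fork c d) = (result c, result d)"
  "work (fork c d) = 1 + work c + work d"
  "cspan (fork c d) = 1 + max (cspan c) (cspan d)"
  by (simp_all add: fork_def)

section \<open>Size, depth and shape of sequence trees\<close>

fun elems :: "'a seq \<Rightarrow> 'a list" where
  "elems SEmpty = []"
| "elems (SOne x) = [x]"
| "elems (SCat l r) = elems l @ elems r"

fun leaves :: "'a seq \<Rightarrow> nat" where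
  "leaves SEmpty = 1"
| "leaves (SOne x) = 1"
| "leaves (SCat l r) = leaves l + leaves r"

fun depth :: "'a seq \<Rightarrow> nat" where
  "depth SEmpty = 0"
| "depth (SOne x) = 0"
| "depth (SCat l r) = Suc (max (depth l) (depth r))"

fun full :: "'a seq \<Rightarrow> bool" where
  "full SEmpty = False"
| "full (SOne x) = True"
| "full (SCat l r) = (full l \<and> full r)"

text \<open>The invariant behind \<open>sjoin\<close>: an empty leaf occurs only as the whole tree.
  It turns costs counted in \<open>leaves\<close> into costs counted in elements, up to the single
  leaf of the empty tree.\<close>

definition pruned :: "'a seq \<Rightarrow> bool" where
  "pruned t \<longleftrightarrow> t = SEmpty \<or> full t"

lemma pruned_simps [simp]: "pruned SEmpty" "pruned (SOne x)"
  by (simp_all add: pruned_def)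

lemma set_seq_elems: "set_seq t = set (elems t)"
  by (induction t) auto

lemma leaves_full: "full t \<Longrightarrow> leaves t = length (elems t)"
  by (induction t) auto

lemma full_elems: "full t \<Longrightarrow> elems t \<noteq> []"
  by (induction t) auto

lemma leaves_pruned: "pruned t \<Longrightarrow> leaves t \<le> length (elems t) + 1"
  by (auto simp: pruned_def leaves_full)

lemma pruned_elems_Nil: "pruned t \<Longrightarrow> elems t = [] \<longleftrightarrow> t = SEmpty"
  by (auto simp: pruned_def full_elems)

lemma elems_sjoin [simp]: "elems (sjoin s t) = elems s @ elems t"
  by (induction s t rule: sjoin.induct) auto

lemma set_seq_sjoin [simp]: "set_seq (sjoin s t) = set_seq s \<union> set_seq t"
  by (simp add: set_seq_elems)

lemma depth_sjoin: "depth (sjoin s t) \<le> Suc (max (depth s) (depth t))"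
  by (induction s t rule: sjoin.induct) auto

lemma pruned_sjoin: "pruned s \<Longrightarrow> pruned t \<Longrightarrow> pruned (sjoin s t)"
  by (induction s t rule: sjoin.induct) (auto simp: pruned_def)

lemma elems_map_seq [simp]: "elems (map_seq h t) = map h (elems t)"
  by (induction t) auto

lemma leaves_map_seq [simp]: "leaves (map_seq h t) = leaves t"
  by (induction t) auto

lemma depth_map_seq [simp]: "depth (map_seq h t) = depth t"
  by (induction t) auto

lemma full_map_seq [simp]: "full (map_seq h t) = full t"
  by (induction t) auto

lemma pruned_map_seq [simp]: "pruned (map_seq h t) = pruned t"
  unfolding pruned_def by (cases t) auto

text \<open>An inner node costs 2, an empty leaf 1, and there is one inner node fewer than leaves.
  The 2 added on the left absorbs the node cost in the induction.\<close>

lemma work_mapreduce: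
  "work (mapreduce g z f t) + 2 \<le> (\<Sum>x\<leftarrow>elems t. work (f x)) + 3 * leaves t"
  by (induction t) auto

lemma cspan_mapreduce:
  assumes "\<And>x. x \<in> set (elems t) \<Longrightarrow> cspan (f x) \<le> M"
  shows "cspan (mapreduce g z f t) \<le> 2 * depth t + M + 1"
  using assms
proof (induction t)
  case (SCat l r)
  have "cspan (mapreduce g z f l) \<le> 2 * depth l + M + 1" "cspan (mapreduce g z f r) \<le> 2 * depth r + M + 1"
    using SCat by auto
  then show ?case by auto
qed auto

lemma result_mapreduce_sum:
  "result (mapreduce (+) 0 f t) = (\<Sum>x\<leftarrow>elems t. result (f x))" for f :: "'a \<Rightarrow> nat costed"
  by (induction t) auto

lemma result_mapreduce_max:
  "result (mapreduce max 0 f t) = Max (insert 0 ((\<lambda>x. result (f x)) ` set (elems t)))"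
  for f :: "'a \<Rightarrow> nat costed"
proof (induction t)
  case (SCat l r)
  let ?h = "\<lambda>x. result (f x)"
  have "insert 0 (?h ` set (elems (SCat l r))) =
      insert 0 (?h ` set (elems l)) \<union> insert 0 (?h ` set (elems r))"
    by auto
  then show ?case
    using SCat by (simp only:) (subst Max_Un; simp)
qed auto

lemma elems_mapreduce_sjoin:
  "elems (result (mapreduce sjoin SEmpty f t)) = concat (map (\<lambda>x. elems (result (f x))) (elems t))"
  by (induction t) auto

lemma pruned_mapreduce_sjoin:
  assumes "\<And>x. x \<in> set (elems t) \<Longrightarrow> pruned (result (f x))"
  shows "pruned (result (mapreduce sjoin SEmpty f t))"
  using assms by (induction t) (auto intro: pruned_sjoin)

text \<open>\<open>sjoin\<close> adds a level only where the input tree already has an inner node,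
  and each leaf is replaced by a tree without inner nodes.\<close>

lemma depth_mapreduce_sjoin:
  assumes "\<And>x. x \<in> set (elems t) \<Longrightarrow> depth (result (f x)) = 0"
  shows "depth (result (mapreduce sjoin SEmpty f t)) \<le> depth t"
  using assms
proof (induction t)
  case (SCat l r)
  let ?m = "mapreduce sjoin SEmpty f"
  have "depth (result (?m l)) \<le> depth l" "depth (result (?m r)) \<le> depth r"
    using SCat by auto
  then show ?case
    using depth_sjoin[of "result (?m l)" "result (?m r)"] by (auto simp: max_def split: if_splits)
qed auto

lemma result_scount [simp]: "result (scount t) = length (elems t)"
  by (simp add: scount_def result_mapreduce_sum sum_list_triv)

lemma work_scount: "work (scount t) + 2 \<le> length (elems t) + 3 * leaves t"
  using work_mapreduce[of "(+)" 0 "\<lambda>_. unit_op 1" t] by (simp add: scount_def sum_list_triv del: One_nat_def)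

lemma cspan_scount: "cspan (scount t) \<le> 2 * depth t + 2"
  using cspan_mapreduce[of t "\<lambda>_. unit_op 1" 1 "(+)" 0] by (simp add: scount_def del: One_nat_def)

lemma result_smap [simp]: "result (smap f t) = map_seq (\<lambda>x. result (f x)) t"
  unfolding smap_def by (induction t) auto

lemma work_smap: "work (smap f t) + 2 \<le> (\<Sum>x\<leftarrow>elems t. work (f x) + 1) + 3 * leaves t"
  unfolding smap_def by (rule order_trans[OF work_mapreduce]) simp

lemma cspan_smap:
  assumes "\<And>x. x \<in> set (elems t) \<Longrightarrow> cspan (f x) \<le> M"
  shows "cspan (smap f t) \<le> 2 * depth t + M + 2"
  using assms cspan_mapreduce[of t "\<lambda>x. f x \<bind> (\<lambda>y. unit_op (SOne y))" "M + 1" SCat SEmpty]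
  by (simp add: smap_def)

lemma elems_sfilter [simp]:
  "elems (result (sfilter p t)) = filter (\<lambda>x. result (p x)) (elems t)"
  unfolding sfilter_def by (induction t) auto

lemma work_sfilter: "work (sfilter p t) + 2 \<le> (\<Sum>x\<leftarrow>elems t. work (p x) + 1) + 3 * leaves t"
  unfolding sfilter_def by (rule order_trans[OF work_mapreduce]) simp

lemma cspan_sfilter:
  assumes "\<And>x. x \<in> set (elems t) \<Longrightarrow> cspan (p x) \<le> M"
  shows "cspan (sfilter p t) \<le> 2 * depth t + M + 2"
  using assms cspan_mapreduce[of t "\<lambda>x. p x \<bind> (\<lambda>b. unit_op (if b then SOne x else SEmpty))" "M + 1" sjoin SEmpty]
  by (simp add: sfilter_def)

lemma pruned_sfilter: "pruned (result (sfilter p t))"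
  unfolding sfilter_def by (intro pruned_mapreduce_sjoin) auto

lemma depth_sfilter: "depth (result (sfilter p t)) \<le> depth t"
  unfolding sfilter_def by (intro depth_mapreduce_sjoin) auto

lemma result_par_write: "result (par_write M t) = fold (\<lambda>(v, x) M. M(v := x)) (elems t) M"
  by (induction M t rule: par_write.induct) (auto simp: Let_def)

lemma fold_fun_upd_notin:
  "v \<notin> fst ` set xs \<Longrightarrow> fold (\<lambda>(v, x) M. M(v := x)) xs M v = M v"
  by (induction xs arbitrary: M) (auto split: prod.splits)

lemma fold_fun_upd_in:
  "distinct (map fst xs) \<Longrightarrow> (v, x) \<in> set xs \<Longrightarrow> fold (\<lambda>(v, x) M. M(v := x)) xs M v = x"
  by (induction xs arbitrary: M) (auto simp: fold_fun_upd_notin)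

lemma work_par_write: "work (par_write M t) + 1 \<le> 2 * leaves t"
  by (induction M t rule: par_write.induct) (auto simp: Let_def)

lemma cspan_par_write: "cspan (par_write M t) \<le> depth t + 1"
  by (induction M t rule: par_write.induct) (auto simp: Let_def)

text \<open>\<open>d\<close> stands for a rounded-up binary logarithm of the length. It stays
  arbitrary in the induction: if \<open>d = Suc d'\<close>, both halves, including the longer one,
  fit into \<open>2 ^ d'\<close>. The \<open>max 1\<close> pays for the empty array.\<close>

lemma of_array_costs:
  "elems (result (of_array xs)) = xs \<and> pruned (result (of_array xs)) \<and>
   work (of_array xs) + 2 \<le> 3 * max 1 (length xs) \<and>
   (length xs \<le> 2 ^ d \<longrightarrow> depth (result (of_array xs)) \<le> d \<and> cspan (of_array xs) \<le> 2 * d + 1)"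
proof (induction xs arbitrary: d rule: of_array.induct)
  case (1 xs)
  consider "xs = []" | "length xs = 1" | "length xs \<ge> 2"
    by (cases xs; cases "tl xs") auto
  then show ?case
  proof cases
    case 1
    then show ?thesis by (simp add: of_array.simps)
  next
    case 2
    then obtain x where "xs = [x]" by (auto simp: length_Suc_conv)
    then show ?thesis by (simp add: of_array.simps)
  next
    case 3
    define h where "h = length xs div 2"
    let ?l = "of_array (take h xs)" and ?r = "of_array (drop h xs)"
    have *: "of_array xs = cbind (fork ?l ?r) (\<lambda>(l, r). unit_op (SCat l r))"
      using 3 by (subst of_array.simps) (auto simp: h_def Let_def)
    have h: "0 < h" "h < length xs" "length (take h xs) = h" "length (drop h xs) = length xs - h"
      using 3 by (auto simp: h_def)
    note IH = 1(1)[of h] 1(2)[of h]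
    have prem: "xs \<noteq> []" "length xs \<noteq> 1" using 3 by auto
    have f: "elems (result ?l) = take h xs" "elems (result ?r) = drop h xs"
      "pruned (result ?l)" "pruned (result ?r)"
      using IH prem by (auto simp: h_def)
    have w: "work ?l + 2 \<le> 3 * h" "work ?r + 2 \<le> 3 * (length xs - h)"
      using IH[of d] prem h by (auto simp: h_def)
    \<comment> \<open>A node is pruned only above two nonempty trees; both halves are nonempty
      because the length is at least 2.\<close>
    have full: "full (result ?l)" "full (result ?r)"
      using f h pruned_elems_Nil[of "result ?l"] pruned_elems_Nil[of "result ?r"] by (auto simp: pruned_def)
    have d: "depth (result (of_array xs)) \<le> d \<and> cspan (of_array xs) \<le> 2 * d + 1"
      if len: "length xs \<le> 2 ^ d"
    proof -
      obtain d' where d': "d = Suc d'"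
        using len 3 by (cases d) auto
      have le: "length (take h xs) \<le> 2 ^ d'" "length (drop h xs) \<le> 2 ^ d'"
        unfolding h using len d' by (auto simp: h_def)
      have "depth (result ?l) \<le> d'" "cspan ?l \<le> 2 * d' + 1" "depth (result ?r) \<le> d'" "cspan ?r \<le> 2 * d' + 1"
        using IH[of d'] prem le by (auto simp: h_def)
      then show ?thesis unfolding * by (auto simp: d')
    qed
    show ?thesis
      using d f full w h unfolding * by (auto simp: pruned_def)
  qed
qed

section \<open>Culling and random bucketing of graphs\<close>

lemma simple_graph_finite:
  assumes "simple_graph G"
  shows "finite (verts G)" "finite (edges G)"
proof -
  show "finite (verts G)" using assms by (simp add: simple_graph_def)
  then show "finite (edges G)"
    using assms by (intro finite_subset[of "edges G" "Pow (verts G)"]) (auto simp: simple_graph_def)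
qed

lemma handshake:
  assumes G: "simple_graph G"
  shows "(\<Sum>v\<in>verts G. deg G v) = 2 * card (edges G)"
proof -
  note fin = simple_graph_finite[OF G]
  have "(\<Sum>v\<in>verts G. deg G v) = (\<Sum>v\<in>verts G. \<Sum>e\<in>edges G. if v \<in> e then 1 else 0)"
    using fin by (simp add: deg_def sum.If_cases Int_def)
  also have "\<dots> = (\<Sum>e\<in>edges G. \<Sum>v\<in>verts G. if v \<in> e then 1 else 0)"
    by (rule sum.swap)
  also have "\<dots> = (\<Sum>e\<in>edges G. 2)"
  proof (rule sum.cong)
    fix e assume e: "e \<in> edges G"
    then have "verts G \<inter> e = e" "card e = 2" using G by (auto simp: simple_graph_def)
    then show "(\<Sum>v\<in>verts G. if v \<in> e then 1 else 0) = (2::nat)"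
      using fin by (simp add: sum.If_cases)
  qed simp
  finally show ?thesis by simp
qed

text \<open>The program sees a degree as the length of a neighbour array, whereas \<open>deg\<close>
  counts edges; the map from \<open>u\<close> to the edge \<open>{v, u}\<close> is the bijection
  between the two.\<close>

lemma deg_eq_card_neighbours:
  assumes G: "simple_graph G"
  shows "deg G v = card {u. {v, u} \<in> edges G}"
proof -
  have "{e \<in> edges G. v \<in> e} = (\<lambda>u. {v, u}) ` {u. {v, u} \<in> edges G}"
  proof (intro equalityI subsetI)
    fix e assume e: "e \<in> {e \<in> edges G. v \<in> e}"
    then have "card e = 2" using G by (auto simp: simple_graph_def)
    then obtain x y where "e = {x, y}" by (meson card_2_iff)
    with e show "e \<in> (\<lambda>u. {v, u}) ` {u. {v, u} \<in> edges G}" by (auto simp: insert_commute)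
  qed auto
  moreover have "inj (\<lambda>u. {v, u})" by (rule injI) (metis doubleton_eq_iff)
  ultimately show ?thesis by (simp add: deg_def card_image inj_on_subset)
qed

lemma simple_graph_induced: "simple_graph G \<Longrightarrow> simple_graph (induced G U)"
  by (auto simp: simple_graph_def induced_def)

lemma induced_induced: "induced (induced G U) W = induced G (U \<inter> W)"
  by (auto simp: induced_def)

lemma induced_verts: "simple_graph G \<Longrightarrow> induced G (verts G) = G"
  by (auto simp: induced_def simple_graph_def prod_eq_iff)

text \<open>Crude, but only the logarithm matters: it makes the logarithm of the edge number at most
  \<open>2 * log 2 n\<close>.\<close>

lemma card_edges_le:
  assumes G: "simple_graph G"
  shows "card (edges G) \<le> card (verts G) ^ 2"
proof -
  note fin = simple_graph_finite[OF G]
  have "edges G \<subseteq> (\<lambda>(u, v). {u, v}) ` (verts G \<times> verts G)"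
  proof
    fix e assume e: "e \<in> edges G"
    then have *: "card e = 2" "e \<subseteq> verts G" using G by (auto simp: simple_graph_def)
    then obtain x y where "e = {x, y}" by (meson card_2_iff)
    with * show "e \<in> (\<lambda>(u, v). {u, v}) ` (verts G \<times> verts G)" by auto
  qed
  then have "card (edges G) \<le> card (verts G \<times> verts G)"
    using fin by (meson card_image_le card_mono finite_SigmaI finite_imageI le_trans)
  then show ?thesis by (simp add: card_cartesian_product power2_eq_square)
qed

lemma deg_le_max_deg: "finite (verts G) \<Longrightarrow> v \<in> verts G \<Longrightarrow> deg G v \<le> max_deg G"
  by (auto simp: max_deg_def)

lemma max_deg_attained:
  assumes "finite (verts G)" "max_deg G > 0"
  obtains v where "v \<in> verts G" "deg G v = max_deg G"
proof -
  have "max_deg G \<in> insert 0 (deg G ` verts G)"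
    unfolding max_deg_def using assms by (intro Max_in) auto
  then show ?thesis using assms that by auto
qed

section \<open>Effect of one culling phase on edges and culled vertices\<close>

abbreviation cull :: "nat \<Rightarrow> nat \<Rightarrow> 'a graph \<Rightarrow> 'a graph" where
  "cull n k H \<equiv> induced H (verts H - heavy n k H)"

context
  fixes n k :: nat
  assumes n: "n \<ge> 2" and k: "k \<ge> 1"
begin

lemma log_ge_1: "log 2 (real n) \<ge> 1"
  using n by (simp add: le_log_iff)

lemma quota_pos: "real k ^ 4 * log 2 n > 0"
  using log_ge_1 k by (intro mult_pos_pos) auto

lemma tau_nonneg: "tau n k H \<ge> 0"
  unfolding tau_def using quota_pos by (intro divide_nonneg_nonneg) auto

text \<open>Thresholds are nonnegative, so a running phase has a vertex of positive degree. This
  permits division by the number of edges and keeps its logarithm nonnegative in the loop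
  bounds.\<close>

lemma edges_pos_if_max_deg_gt_tau:
  assumes H: "simple_graph H" and gt: "max_deg H > tau n k H"
  shows "card (edges H) > 0"
proof -
  have "max_deg H > 0" using gt tau_nonneg[of H] by linarith
  then obtain v where "v \<in> verts H" "deg H v > 0"
    using max_deg_attained simple_graph_finite[OF H] by metis
  then have "{e \<in> edges H. v \<in> e} \<noteq> {}" by (force simp: deg_def)
  then show ?thesis using simple_graph_finite[OF H] by (auto simp: card_gt_0_iff)
qed

lemma card_heavy_le:
  assumes H: "simple_graph H" and gt: "max_deg H > tau n k H"
  shows "real (card (heavy n k H)) \<le> 4 * (real k ^ 4 * log 2 n)"
proof -
  let ?e = "real (card (edges H))" and ?q = "real k ^ 4 * log 2 n"
  have fin: "finite (verts H)" "heavy n k H \<subseteq> verts H"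
    using simple_graph_finite[OF H] by (auto simp: heavy_def)
  have e: "?e > 0" using edges_pos_if_max_deg_gt_tau[OF assms] by simp
  have "real (card (heavy n k H)) * (?e / ?q / 2) = (\<Sum>v\<in>heavy n k H. tau n k H / 2)"
    by (simp add: tau_def)
  also have "\<dots> \<le> (\<Sum>v\<in>heavy n k H. real (deg H v))"
    by (intro sum_mono) (auto simp: heavy_def)
  also have "\<dots> \<le> (\<Sum>v\<in>verts H. real (deg H v))"
    using fin by (intro sum_mono2) auto
  also have "\<dots> = 2 * ?e"
    using handshake[OF H] by (simp flip: of_nat_sum)
  finally have le: "real (card (heavy n k H)) * (?e / ?q / 2) \<le> 2 * ?e" .
  have "h \<le> 4 * q" if "h * (x / q / 2) \<le> 2 * x" "x > 0" "q > 0" for h q x :: real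
    using that by (simp add: field_simps)
  from this[OF le e quota_pos] show ?thesis .
qed

text \<open>A vertex of maximum degree disappears together with its edges. Unlike the halving, this
  descent is available for every phase that runs, so it is what the induction over the loop rests
  on.\<close>

lemma card_edges_cull_less:
  assumes H: "simple_graph H" and gt: "max_deg H > tau n k H"
  shows "card (edges (cull n k H)) < card (edges H)"
proof -
  have pos: "max_deg H > 0" using gt tau_nonneg[of H] by linarith
  then obtain v where v: "v \<in> verts H" "deg H v = max_deg H"
    using max_deg_attained simple_graph_finite[OF H] by metis
  then have "{e \<in> edges H. v \<in> e} \<noteq> {}" using pos by (force simp: deg_def)
  then obtain e where e: "e \<in> edges H" "v \<in> e" by auto
  have "v \<in> heavy n k H"
    using v gt tau_nonneg[of H] by (auto simp: heavy_def)
  with e have "e \<notin> edges (cull n k H)" by (auto simp: induced_def)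
  with e show ?thesis
    using simple_graph_finite[OF H] by (intro psubset_card_mono) (auto simp: induced_def)
qed

lemma card_edges_cull_halved:
  assumes H: "simple_graph H" and gt: "max_deg (cull n k H) > tau n k (cull n k H)"
  shows "2 * card (edges (cull n k H)) < card (edges H)"
proof -
  let ?H' = "cull n k H"
  have H': "simple_graph ?H'" using H by (rule simple_graph_induced)
  have "max_deg ?H' > 0" using gt tau_nonneg[of ?H'] by linarith
  then obtain v where v: "v \<in> verts ?H'" "deg ?H' v = max_deg ?H'"
    using max_deg_attained simple_graph_finite[OF H'] by metis
  have "deg ?H' v \<le> deg H v"
    unfolding deg_def using simple_graph_finite[OF H] by (intro card_mono) (auto simp: induced_def)
  also have "real (deg H v) \<le> tau n k H / 2"
    using v by (auto simp: induced_def heavy_def)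
  finally have "2 * tau n k ?H' < tau n k H" using gt v by simp
  \<comment> \<open>\<open>tau n k\<close> keeps the \<open>n\<close> of the original graph, so both
    thresholds have the same denominator and comparing them compares edge numbers.\<close>
  then have "2 * real (card (edges ?H')) < real (card (edges H))"
    using quota_pos by (simp add: tau_def divide_less_cancel)
  then show ?thesis by linarith
qed

end

section \<open>Concentration of the number of edges inside one bucket\<close>

lemma sum_deg_squared_le:
  assumes H: "simple_graph H"
  shows "(\<Sum>v\<in>verts H. (real (deg H v))\<^sup>2) \<le> 2 * real (max_deg H) * card (edges H)"
proof -
  note fin = simple_graph_finite[OF H]
  have "(\<Sum>v\<in>verts H. (real (deg H v))\<^sup>2) \<le> (\<Sum>v\<in>verts H. real (max_deg H) * real (deg H v))"
    using deg_le_max_deg[OF fin(1)] by (intro sum_mono) (auto simp: power2_eq_square intro!: mult_right_mono)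
  also have "\<dots> = real (max_deg H) * real (\<Sum>v\<in>verts H. deg H v)"
    by (simp add: sum_distrib_left)
  finally show ?thesis by (simp add: handshake[OF H])
qed

text \<open>Stated for arbitrary assignments \<open>\<omega>\<close> instead of through the bucket
  as a vertex set, so that changing one coordinate is a plain function update, as bounded
  differences require.\<close>

definition mono_edges :: "'a graph \<Rightarrow> ('a \<Rightarrow> nat) \<Rightarrow> nat \<Rightarrow> 'a set set" where
  "mono_edges H \<omega> i = {e \<in> edges H. \<forall>v\<in>e. \<omega> v = i}"

text \<open>Reassigning \<open>v\<close> can create new edges inside bucket \<open>i\<close> only
  among those incident to \<open>v\<close>.\<close>

lemma card_mono_edges_diff:
  assumes H: "simple_graph H"
  shows "real (card (mono_edges H (x(v := y)) i)) - real (card (mono_edges H (x(v := z)) i)) \<le> deg H v"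
proof -
  note fin = simple_graph_finite[OF H]
  have "mono_edges H (x(v := y)) i \<subseteq> mono_edges H (x(v := z)) i \<union> {e \<in> edges H. v \<in> e}"
  proof
    fix e assume e: "e \<in> mono_edges H (x(v := y)) i"
    then have "e \<in> edges H" and eq: "\<And>u. u \<in> e \<Longrightarrow> (x(v := y)) u = i"
      by (auto simp: mono_edges_def)
    then show "e \<in> mono_edges H (x(v := z)) i \<union> {e \<in> edges H. v \<in> e}"
      unfolding mono_edges_def by (cases "v \<in> e") fastforce+
  qed
  then have "card (mono_edges H (x(v := y)) i) \<le> card (mono_edges H (x(v := z)) i \<union> {e \<in> edges H. v \<in> e})"
    using fin by (intro card_mono) (auto simp: mono_edges_def)
  also have "\<dots> \<le> card (mono_edges H (x(v := z)) i) + deg H v"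
    unfolding deg_def by (rule card_Un_le)
  finally show ?thesis by linarith
qed

lemma expectation_card_mono_edges:
  assumes H: "simple_graph H" and i: "i < k"
  shows "measure_pmf.expectation (Pi_pmf (verts H) 0 (\<lambda>_. pmf_of_set {..<k}))
    (\<lambda>\<omega>. real (card (mono_edges H \<omega> i))) = card (edges H) / (real k)\<^sup>2"
proof -
  note fin = simple_graph_finite[OF H]
  let ?P = "Pi_pmf (verts H) 0 (\<lambda>_. pmf_of_set {..<k})"
  have k: "{..<k} \<noteq> {}" using i by auto
  have prob: "measure_pmf.prob ?P {\<omega>. \<forall>v\<in>e. \<omega> v = i} = 1 / (real k)\<^sup>2" if e: "e \<in> edges H" for e
  proof -
    have sub: "e \<subseteq> verts H" "card e = 2" using e H by (auto simp: simple_graph_def)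
    \<comment> \<open>A product set that constrains only the two endpoints of \<open>e\<close>, so
      its probability factors into two terms \<open>1 / k\<close> and otherwise ones.\<close>
    define B where "B = (\<lambda>v. if v \<in> e then {i} else (UNIV :: nat set))"
    have "{\<omega>. \<forall>v\<in>e. \<omega> v = i} = Pi (verts H) B"
      using sub by (auto simp: B_def Pi_def split: if_splits)
    then have "measure_pmf.prob ?P {\<omega>. \<forall>v\<in>e. \<omega> v = i} =
        (\<Prod>v\<in>verts H. measure_pmf.prob (pmf_of_set {..<k}) (B v))"
      using fin by (simp add: measure_Pi_pmf_Pi)
    also have "\<dots> = (\<Prod>v\<in>verts H. if v \<in> e then 1 / real k else 1)"
      using k i by (intro prod.cong) (auto simp: B_def measure_pmf_of_set)
    also have "\<dots> = (1 / real k) ^ card e"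
      using fin sub by (simp add: prod.If_cases Int_absorb1 Int_absorb2)
    finally show ?thesis using sub by (simp add: power_one_over)
  qed
  have "real (card (mono_edges H \<omega> i)) = (\<Sum>e\<in>edges H. indicator {\<omega>. \<forall>v\<in>e. \<omega> v = i} \<omega>)" for \<omega>
    using fin by (simp add: mono_edges_def indicator_def sum.If_cases Int_def)
  then have "measure_pmf.expectation ?P (\<lambda>\<omega>. real (card (mono_edges H \<omega> i))) =
     measure_pmf.expectation ?P (\<lambda>\<omega>. \<Sum>e\<in>edges H. indicator {\<omega>. \<forall>v\<in>e. \<omega> v = i} \<omega>)"
    by simp
  also have "\<dots> = (\<Sum>e\<in>edges H. measure_pmf.expectation ?P (indicator {\<omega>. \<forall>v\<in>e. \<omega> v = i}))"
    by (intro Bochner_Integration.integral_sum integrable_measure_pmf_finite finite_set_Pi_pmf fin)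
      (use k in auto)
  also have "\<dots> = (\<Sum>e\<in>edges H. 1 / (real k)\<^sup>2)"
    by (intro sum.cong refl) (simp add: prob)
  finally show ?thesis by simp
qed

lemma mono_edges_tail:
  fixes r :: real
  assumes H: "simple_graph H" and i: "i < k" and n: "n \<ge> 2"
    and deg: "max_deg H \<le> tau n k H" and r: "r > 0"
  shows "measure_pmf.prob (Pi_pmf (verts H) 0 (\<lambda>_. pmf_of_set {..<k}))
    {\<omega>. real (card (mono_edges H \<omega> i)) > (1 + r) * (card (edges H) / (real k)\<^sup>2)} \<le> real n powr - r\<^sup>2"
\<comment> \<open>Without edges the variance bound \<open>V\<close> below would be 0, which
  McDiarmid's inequality does not admit.\<close>
proof (cases "card (edges H) = 0")
  case True
  then have "edges H = {}" using simple_graph_finite[OF H] by simp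
  then show ?thesis by (simp add: mono_edges_def)
next
  case False
  let ?P = "Pi_pmf (verts H) 0 (\<lambda>_. pmf_of_set {..<k})"
  let ?X = "\<lambda>\<omega>. real (card (mono_edges H \<omega> i))"
  define e L where "e = real (card (edges H))" and "L = log 2 (real n)"
  have k: "k \<ge> 1" "{..<k} \<noteq> {}" using i by auto
  have e: "e > 0" using False by (simp add: e_def)
  have L: "L \<ge> 1" unfolding L_def using log_ge_1[OF n k(1)] .
  define V where "V = 2 * e\<^sup>2 / (real k ^ 4 * L)"
  have V: "V > 0" using e L k by (auto simp: V_def)
  have sq: "(\<Sum>v\<in>verts H. (real (deg H v))\<^sup>2) \<le> V"
  proof -
    have "(\<Sum>v\<in>verts H. (real (deg H v))\<^sup>2) \<le> 2 * real (max_deg H) * e"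
      using sum_deg_squared_le[OF H] by (simp add: e_def)
    also have "\<dots> \<le> 2 * tau n k H * e"
      using deg e by simp
    also have "\<dots> = V" by (simp add: tau_def V_def e_def L_def power2_eq_square)
    finally show ?thesis .
  qed
  define t where "t = r * (e / (real k)\<^sup>2)"
  have t: "t > 0" using r e k by (auto simp: t_def)
  have "measure_pmf.prob ?P {\<omega>. ?X \<omega> > (1 + r) * (e / (real k)\<^sup>2)} \<le>
     measure_pmf.prob ?P {\<omega>. ?X \<omega> \<ge> measure_pmf.expectation ?P ?X + t}"
    unfolding expectation_card_mono_edges[OF H i]
    by (intro measure_pmf.finite_measure_mono) (auto simp: t_def algebra_simps e_def add_divide_distrib)
  also have "\<dots> \<le> exp (- 2 * t\<^sup>2 / V)"
    using k simple_graph_finite[OF H]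
    by (intro mcdiarmid_inequality[where c = "\<lambda>v. real (deg H v)"] t sq V card_mono_edges_diff H) auto
  \<comment> \<open>Here the threshold pays off: \<open>k ^ 4\<close> and the square of the edge
    number cancel, leaving just the logarithm from \<open>tau\<close>.\<close>
  also have "- 2 * t\<^sup>2 / V = - (r\<^sup>2 * L)"
  proof -
    have "t\<^sup>2 = r\<^sup>2 * (e\<^sup>2 / real k ^ 4)"
      by (simp add: t_def power_mult_distrib power_divide flip: power_mult)
    then show ?thesis using e L k by (simp add: V_def)
  qed
  also have "exp (- (r\<^sup>2 * L)) \<le> exp (- (r\<^sup>2 * ln n))"
  proof -
    \<comment> \<open>The threshold uses the binary logarithm, which dominates the natural one since
      \<open>ln 2 < 1\<close>; this turns the exponential into a power of \<open>n\<close>.\<close>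
    have "ln (real n) \<le> L"
      using n ln_2_less_1 by (simp add: L_def log_def le_divide_eq mult_left_le)
    then show ?thesis by (simp add: mult_left_mono)
  qed
  also have "\<dots> = real n powr - r\<^sup>2"
    using n by (simp add: powr_def)
  finally show ?thesis by (simp add: e_def)
qed

section \<open>A culling phase\<close>

text \<open>Vertices may be missing from the sequence as long as they are isolated, which lets a
  phase drop them. The same \<open>d\<close> bounds the outer tree and all neighbour trees, and
  filtering preserves it from phase to phase.\<close>

definition represents :: "nat \<Rightarrow> 'a graph \<Rightarrow> ('a \<times> 'a seq) seq \<Rightarrow> bool" where
  "represents d G H \<longleftrightarrow> distinct (map fst (elems H)) \<and> pruned H \<and> depth H \<le> d \<and>
     (\<forall>(v, A) \<in> set (elems H). v \<in> verts G \<and> distinct (elems A) \<and>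
        set (elems A) = {u. {v, u} \<in> edges G} \<and> pruned A \<and> depth A \<le> d) \<and>
     (\<forall>v \<in> verts G - fst ` set (elems H). \<forall>u. {v, u} \<notin> edges G)"

lemma represents_elem:
  assumes "represents d G H" "(v, A) \<in> set (elems H)"
  shows "v \<in> verts G" "distinct (elems A)" "set (elems A) = {u. {v, u} \<in> edges G}"
    "pruned A" "depth A \<le> d"
  using assms unfolding represents_def by auto

lemma represents_length:
  assumes G: "simple_graph G" and R: "represents d G H" and vA: "(v, A) \<in> set (elems H)"
  shows "length (elems A) = deg G v"
  using represents_elem[OF R vA] distinct_card[of "elems A"]
  by (simp add: deg_eq_card_neighbours[OF G])

lemma represents_isolated:
  assumes G: "simple_graph G" and R: "represents d G H" and v: "v \<in> verts G" "v \<notin> fst ` set (elems H)"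
  shows "deg G v = 0"
  using R v by (simp add: deg_eq_card_neighbours[OF G] represents_def)

lemma represents_sum:
  assumes G: "simple_graph G" and R: "represents d G H"
  shows "(\<Sum>(v, A)\<leftarrow>elems H. length (elems A)) = 2 * card (edges G)"
proof -
  have sub: "fst ` set (elems H) \<subseteq> verts G"
    using represents_elem(1)[OF R] by auto
  have "(\<Sum>(v, A)\<leftarrow>elems H. length (elems A)) = (\<Sum>v\<leftarrow>map fst (elems H). deg G v)"
    unfolding map_map by (intro arg_cong[of _ _ sum_list] map_cong) (auto simp: represents_length[OF G R])
  also have "\<dots> = (\<Sum>v\<in>fst ` set (elems H). deg G v)"
    using R by (subst sum_list_distinct_conv_sum_set) (auto simp: represents_def)
  also have "\<dots> = (\<Sum>v\<in>verts G. deg G v)"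
    using sub simple_graph_finite[OF G] represents_isolated[OF G R] by (intro sum.mono_neutral_left) auto
  finally show ?thesis by (simp add: handshake[OF G])
qed

text \<open>The inserted 0 stands in for the isolated vertices that the sequence may lack, so both
  maxima range over the same values.\<close>

lemma represents_max:
  assumes G: "simple_graph G" and R: "represents d G H"
  shows "Max (insert 0 ((\<lambda>(v, A). length (elems A)) ` set (elems H))) = max_deg G"
proof -
  have "insert 0 ((\<lambda>(v, A). length (elems A)) ` set (elems H)) = insert 0 (deg G ` verts G)"
  proof (intro equalityI subsetI)
    fix x assume "x \<in> insert 0 ((\<lambda>(v, A). length (elems A)) ` set (elems H))"
    then show "x \<in> insert 0 (deg G ` verts G)"
      using represents_length[OF G R] represents_elem(1)[OF R] by auto
  next
    fix x assume "x \<in> insert 0 (deg G ` verts G)"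
    then consider "x = 0" | v where "v \<in> verts G" "x = deg G v" by auto
    then show "x \<in> insert 0 ((\<lambda>(v, A). length (elems A)) ` set (elems H))"
    proof cases
      case 2
      show ?thesis
      proof (cases "v \<in> fst ` set (elems H)")
        case True
        then obtain A where "(v, A) \<in> set (elems H)" by auto
        then show ?thesis using represents_length[OF G R] 2 by force
      qed (use represents_isolated[OF G R] 2 in auto)
    qed simp
  qed
  then show ?thesis by (simp add: max_deg_def)
qed

text \<open>Each element survives as at most one element with the same key; this keeps the vertices
  of the graph sequence distinct under culling.\<close>

lemma distinct_concat_map_key:
  assumes "distinct (map key xs)" "\<And>x. x \<in> set xs \<Longrightarrow> g x = [] \<or> (\<exists>y. g x = [y] \<and> key' y = key x)"
  shows "distinct (map key' (concat (map g xs)))"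
  using assms
proof (induction xs)
  case (Cons x xs)
  have keys: "key' y \<in> key ` set xs" if "y \<in> set (concat (map g xs))" for y
  proof -
    from that obtain z where "z \<in> set xs" "y \<in> set (g z)" by auto
    with Cons.prems(2)[of z] show ?thesis by auto
  qed
  have dist: "distinct (map key' (concat (map g xs)))"
    using Cons by auto
  have "g x = [] \<or> (\<exists>y. g x = [y] \<and> key' y = key x)"
    using Cons.prems(2) by simp
  then show ?case
  proof (elim disjE exE conjE)
    fix y assume y: "g x = [y]" "key' y = key x"
    have "key x \<notin> key' ` set (concat (map g xs))"
      using keys Cons.prems(1) by (metis distinct.simps(2) image_iff list.set_map list.simps(9))
    then show ?thesis using dist y by simp
  qed (use dist in simp)
qed simp

text \<open>The flags are assumed clear only on the current graph, since outside it they record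
  earlier culls, which the last conclusion says are kept. The work is bounded by listed vertices and
  edges separately because initially isolated vertices may be listed.\<close>

lemma phase_c_correct:
  fixes q :: real and C :: "'a seq"
  assumes n: "n \<ge> 2" and k: "k \<ge> 1" and q: "q = real k ^ 4 * log 2 n"
    and G: "simple_graph G" and R: "represents d G H" and F: "\<And>v. v \<in> verts G \<Longrightarrow> \<not> F v"
  defines "c \<equiv> phase_c q (H, F, C)"
  shows "work c \<le> 40 * (length (elems H) + 2 * card (edges G) + 1)"
    and "cspan c \<le> 20 * (d + 2)"
    and "max_deg G \<le> tau n k G \<Longrightarrow> result c = Inr (F, C)"
    and "max_deg G > tau n k G \<Longrightarrow> \<exists>H' F' C'. result c = Inl (H', F', C') \<and>
      represents d (cull n k G) H' \<and> length (elems H') \<le> 2 * card (edges (cull n k G)) \<and>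
      set_seq C' = set_seq C \<union> heavy n k G \<and>
      (\<forall>v. F' v \<longleftrightarrow> (if v \<in> verts G then v \<in> heavy n k G else F v))"
proof -
  define fd :: "'a \<times> nat \<times> 'a seq \<Rightarrow> nat costed" where "fd = (\<lambda>(v, d, A). unit_op d)"
  define fD :: "'a \<times> 'a seq \<Rightarrow> ('a \<times> nat \<times> 'a seq) costed" where
    "fD = (\<lambda>(v, A). do { d \<leftarrow> scount A; unit_op (v, d, A) })"
  define cD where "cD = smap fD H"
  define D where "D = result cD"
  define cs where "cs = mapreduce (+) 0 fd D"
  define cm where "cm = mapreduce max 0 fd D"
  define \<tau> where "\<tau> = real (result cs) / 2 / q"
  define fW :: "'a \<times> nat \<times> 'a seq \<Rightarrow> ('a \<times> bool) costed" where
    "fW = (\<lambda>(v, d, A). unit_op (v, real d > \<tau> / 2))"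
  define cW where "cW = smap fW D"
  define W where "W = result cW"
  define cF where "cF = par_write F W"
  define F' where "F' = result cF"
  define fX :: "'a \<times> bool \<Rightarrow> 'a seq costed" where "fX = (\<lambda>(v, h). unit_op (if h then SOne v else SEmpty))"
  define cX where "cX = mapreduce sjoin SEmpty fX W"
  define p where "p = (\<lambda>u. do { b \<leftarrow> unit_op (F' u); unit_op (\<not> b) })"
  define fH :: "'a \<times> nat \<times> 'a seq \<Rightarrow> ('a \<times> 'a seq) seq costed" where "fH = (\<lambda>(v, d, A). do {
            h \<leftarrow> unit_op (F' v);
            if h then unit_op SEmpty
            else do {
              A' \<leftarrow> sfilter p A;
              unit_op (if A' = SEmpty then SEmpty else SOne (v, A')) } })"
  define cH where "cH = mapreduce sjoin SEmpty fH D"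
  note defs = fd_def fD_def cD_def D_def cs_def cm_def \<tau>_def fW_def cW_def W_def cF_def F'_def fX_def cX_def
    p_def fH_def cH_def
  have c: "c = cbind cD (\<lambda>D. cbind (mapreduce (+) 0 fd D) (\<lambda>s. cbind (mapreduce max 0 fd D) (\<lambda>\<Delta>.
     do { e \<leftarrow> unit_op (real s / 2);
     \<tau> \<leftarrow> unit_op (e / q);
     \<tau>2 \<leftarrow> unit_op (\<tau> / 2);
     continue \<leftarrow> unit_op (real \<Delta> > \<tau>);
     if \<not> continue then ret (Inr (F, C))
     else do {
       W \<leftarrow> smap (\<lambda>(v, d, A). unit_op (v, real d > \<tau>2)) D;
       F' \<leftarrow> par_write F W;
       X \<leftarrow> mapreduce sjoin SEmpty (\<lambda>(v, h). unit_op (if h then SOne v else SEmpty)) W;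
       C' \<leftarrow> unit_op (sjoin C X);
       H' \<leftarrow> mapreduce sjoin SEmpty
         (\<lambda>(v, d, A). do {
            h \<leftarrow> unit_op (F' v);
            if h then unit_op SEmpty
            else do {
              A' \<leftarrow> sfilter (\<lambda>u. do { b \<leftarrow> unit_op (F' u); unit_op (\<not> b) }) A;
              unit_op (if A' = SEmpty then SEmpty else SOne (v, A')) } }) D;
       ret (Inl (H', F', C')) } })))"
    unfolding c_def phase_c_def cD_def fD_def fd_def by simp
  have res: "result c = (if real (result cm) > \<tau> then Inl (result cH, F', sjoin C (result cX)) else Inr (F, C))"
    unfolding c defs
    by (simp only: costed_cbind costed_unit_op costed_ret simp_thms add_0 add_0_right split: if_split)
      (auto simp only: add_0_right ac_simps)
  \<comment> \<open>The 4 counts the scalar operations before the branch, the 1 the concatenation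
    with the earlier culled vertices.\<close>
  have wk: "work c = work cD + work cs + work cm + 4 +
     (if real (result cm) > \<tau> then work cW + work cF + work cX + 1 + work cH else 0)"
    unfolding c defs
    by (simp only: costed_cbind costed_unit_op costed_ret simp_thms add_0 add_0_right split: if_split)
      (auto simp only: add_0_right ac_simps)
  have sp: "cspan c = cspan cD + cspan cs + cspan cm + 4 +
     (if real (result cm) > \<tau> then cspan cW + cspan cF + cspan cX + 1 + cspan cH else 0)"
    unfolding c defs
    by (simp only: costed_cbind costed_unit_op costed_ret simp_thms add_0 add_0_right split: if_split)
      (auto simp only: add_0_right ac_simps)

  define N where "N = length (elems H)"
  define T where "T = (\<Sum>(v, A)\<leftarrow>elems H. length (elems A))"
  have T: "T = 2 * card (edges G)" unfolding T_def by (rule represents_sum[OF G R])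
  have T': "T = (\<Sum>x\<leftarrow>elems H. length (elems (snd x)))"
    by (simp add: T_def case_prod_unfold)
  have leaves: "leaves H \<le> N + 1" and depth: "depth H \<le> d"
    using R leaves_pruned[of H] by (auto simp: represents_def N_def)
  have leavesA: "leaves (snd x) \<le> length (elems (snd x)) + 1" and depthA: "depth (snd x) \<le> d"
    if "x \<in> set (elems H)" for x
    using represents_elem[OF R, of "fst x" "snd x"] that leaves_pruned[of "snd x"] by auto
  have D: "D = map_seq (\<lambda>x. (fst x, length (elems (snd x)), snd x)) H"
    by (simp add: D_def cD_def fD_def case_prod_beta)
  have W: "W = map_seq (\<lambda>x. (fst x, real (length (elems (snd x))) > \<tau> / 2)) H"
    by (simp add: W_def cW_def D fW_def case_prod_beta seq.map_comp comp_def)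
  have sum_fD: "(\<Sum>x\<leftarrow>elems H. work (fD x) + 1) \<le> (\<Sum>x\<leftarrow>elems H. 4 * length (elems (snd x)) + 3)"
  proof (rule sum_list_mono)
    fix x assume "x \<in> set (elems H)"
    then show "work (fD x) + 1 \<le> 4 * length (elems (snd x)) + 3"
      using work_scount[of "snd x"] leavesA[of x] by (simp add: fD_def case_prod_beta)
  qed
  have wD: "work cD \<le> 4 * T + 3 * N + 3 * (N + 1)"
    using work_smap[of fD H] sum_fD leaves
    by (simp add: cD_def sum_list_addf sum_list_const_mult sum_list_triv T' N_def)
  have ws: "work cs \<le> N + 3 * (N + 1)"
    using work_mapreduce[of "(+)" 0 fd D] leaves
    by (simp add: cs_def D fd_def comp_def sum_list_triv N_def)
  have wm: "work cm \<le> N + 3 * (N + 1)"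
    using work_mapreduce[of max 0 fd D] leaves
    by (simp add: cm_def D fd_def comp_def sum_list_triv N_def)
  have wW: "work cW \<le> 2 * N + 3 * (N + 1)"
    using work_smap[of fW D] leaves
    by (simp add: cW_def D fW_def comp_def sum_list_triv N_def)
  have wF: "work cF \<le> 2 * (N + 1)"
    using work_par_write[of F W] leaves by (simp add: cF_def W)
  have wX: "work cX \<le> N + 3 * (N + 1)"
    using work_mapreduce[of sjoin SEmpty fX W] leaves
    by (simp add: cX_def W fX_def comp_def sum_list_triv N_def)
  have sum_fH: "(\<Sum>x\<leftarrow>elems D. work (fH x)) \<le> (\<Sum>x\<leftarrow>elems H. 6 * length (elems (snd x)) + 6)"
    unfolding D elems_map_seq map_map
  proof (rule sum_list_mono)
    fix x assume x: "x \<in> set (elems H)"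
    have "work (sfilter p A) + 2 \<le> 3 * length (elems A) + 3 * leaves A" for A
      using work_sfilter[of p A] by (simp add: p_def sum_list_triv)
    from this[of "snd x"] show "((\<lambda>x. work (fH x)) \<circ> (\<lambda>x. (fst x, length (elems (snd x)), snd x))) x
        \<le> 6 * length (elems (snd x)) + 6"
      using leavesA[OF x] by (simp add: fH_def)
  qed
  have wH: "work cH \<le> 6 * T + 6 * N + 3 * (N + 1)"
    using work_mapreduce[of sjoin SEmpty fH D] sum_fH leaves
    by (simp add: cH_def D sum_list_addf sum_list_const_mult sum_list_triv T' N_def)
  show "work c \<le> 40 * (length (elems H) + 2 * card (edges G) + 1)"
    unfolding wk T[symmetric] N_def[symmetric] using wD ws wm wW wF wX wH by auto

  have sD: "cspan cD \<le> 2 * d + (2 * d + 3) + 2"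
  proof -
    have "cspan (fD x) \<le> 2 * d + 3" if "x \<in> set (elems H)" for x
      using cspan_scount[of "snd x"] depthA[OF that] by (simp add: fD_def case_prod_beta)
    then show ?thesis using cspan_smap[of H fD "2 * d + 3"] depth by (simp add: cD_def)
  qed
  have ss: "cspan cs \<le> 2 * d + 2" and sm: "cspan cm \<le> 2 * d + 2"
    using cspan_mapreduce[of D fd 1 "(+)" 0] cspan_mapreduce[of D fd 1 max 0] depth
    by (auto simp: cs_def cm_def D fd_def)
  have sW: "cspan cW \<le> 2 * d + 3"
    using cspan_smap[of D fW 1] depth by (auto simp: cW_def D fW_def)
  have sF: "cspan cF \<le> d + 1"
    using cspan_par_write[of F W] depth by (simp add: cF_def W)
  have sX: "cspan cX \<le> 2 * d + 2"
    using cspan_mapreduce[of W fX 1 sjoin SEmpty] depth by (auto simp: cX_def W fX_def)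
  have sH: "cspan cH \<le> 2 * d + (2 * d + 6) + 1"
  proof -
    have "cspan (fH x) \<le> 2 * d + 6" if xD: "x \<in> set (elems D)" for x
    proof -
      obtain v A where x: "x = (v, length (elems A), A)" "(v, A) \<in> set (elems H)"
        using xD by (auto simp: D)
      show ?thesis
        using cspan_sfilter[of A p 2] depthA[OF x(2)] by (simp add: x fH_def p_def)
    qed
    then show ?thesis using cspan_mapreduce[of D fH "2 * d + 6" sjoin SEmpty] depth by (simp add: cH_def D)
  qed
  show "cspan c \<le> 20 * (d + 2)"
    unfolding sp using sD ss sm sW sF sX sH by auto

  \<comment> \<open>The program halves the degree sum, which is twice the number of edges, so its
    threshold is exactly \<open>tau\<close>.\<close>
  have "result cs = T"
    by (simp add: cs_def result_mapreduce_sum D fd_def comp_def T')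
  then have \<tau>: "\<tau> = tau n k G"
    by (simp add: \<tau>_def T tau_def q)
  have \<Delta>: "result cm = max_deg G"
    using represents_max[OF G R] by (simp add: cm_def result_mapreduce_max D fd_def case_prod_beta image_image)
  show "max_deg G \<le> tau n k G \<Longrightarrow> result c = Inr (F, C)"
    by (simp add: res \<tau> \<Delta>)

  assume gt: "max_deg G > tau n k G"
  let ?G' = "cull n k G"
  have key: "distinct (map fst (elems W))" "map fst (elems W) = map fst (elems H)"
    using R by (auto simp: W represents_def comp_def)
  have F': "F' v \<longleftrightarrow> (if v \<in> verts G then v \<in> heavy n k G else F v)" for v
  proof (cases "v \<in> fst ` set (elems H)")
    case True
    then obtain A where A: "(v, A) \<in> set (elems H)" by auto
    then have "(v, real (length (elems A)) > \<tau> / 2) \<in> set (elems W)"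
      by (force simp: W)
    then have "F' v \<longleftrightarrow> real (length (elems A)) > \<tau> / 2"
      using fold_fun_upd_in[OF key(1)] by (simp add: F'_def cF_def result_par_write)
    then show ?thesis
      using represents_elem(1)[OF R A] represents_length[OF G R A] by (simp add: heavy_def \<tau>)
  next
    \<comment> \<open>No write reaches \<open>v\<close>. If \<open>v\<close> lies in
      \<open>G\<close>, it is isolated, and degree 0 never exceeds a nonnegative threshold, so its
      clear flag is still right.\<close>
    case False
    then have "v \<notin> fst ` set (elems W)"
      using key(2) by (metis list.set_map)
    then have "F' v = F v"
      by (simp add: F'_def cF_def result_par_write fold_fun_upd_notin)
    moreover have "\<not> F v \<and> v \<notin> heavy n k G" if "v \<in> verts G"
      using F[OF that] represents_isolated[OF G R that False] tau_nonneg[OF n k, of G]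
      by (auto simp: heavy_def)
    ultimately show ?thesis by auto
  qed
  have X: "set_seq (result cX) = heavy n k G"
  proof -
    have "set_seq (result cX) = {v. \<exists>A. (v, A) \<in> set (elems H) \<and> real (length (elems A)) > \<tau> / 2}"
      by (auto simp: set_seq_elems cX_def elems_mapreduce_sjoin W fX_def split: if_splits)
    also have "\<dots> = heavy n k G"
    proof (intro equalityI subsetI)
      fix v assume "v \<in> {v. \<exists>A. (v, A) \<in> set (elems H) \<and> real (length (elems A)) > \<tau> / 2}"
      then show "v \<in> heavy n k G"
        using represents_elem(1)[OF R] represents_length[OF G R] by (auto simp: heavy_def \<tau>)
    next
      fix v assume v: "v \<in> heavy n k G"
      then have "v \<in> verts G" "deg G v > 0"
        using tau_nonneg[OF n k, of G] by (auto simp: heavy_def)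
      then have "v \<in> fst ` set (elems H)"
        using represents_isolated[OF G R, of v] by auto
      then obtain A where "(v, A) \<in> set (elems H)" by auto
      then show "v \<in> {v. \<exists>A. (v, A) \<in> set (elems H) \<and> real (length (elems A)) > \<tau> / 2}"
        using v represents_length[OF G R] by (auto simp: heavy_def \<tau>)
    qed
    finally show ?thesis .
  qed
  define H' where "H' = result cH"
  define A' where "A' = (\<lambda>A. result (sfilter p A))"
  have A': "elems (A' A) = filter (\<lambda>u. \<not> F' u) (elems A)" "pruned (A' A)" "depth (A' A) \<le> depth A" for A
    by (simp_all add: A'_def p_def pruned_sfilter depth_sfilter)
  have fH: "result (fH (v, m, A)) = (if F' v \<or> A' A = SEmpty then SEmpty else SOne (v, A' A))" for v m A
    by (simp add: fH_def A'_def)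
  have elems_H': "elems H' = concat (map (\<lambda>(v, A). if F' v \<or> A' A = SEmpty then [] else [(v, A' A)]) (elems H))"
    by (auto simp: H'_def cH_def elems_mapreduce_sjoin D fH case_prod_beta comp_def intro!: arg_cong[of _ _ concat])
  have in_H': "(v, B) \<in> set (elems H') \<longleftrightarrow> (\<exists>A. (v, A) \<in> set (elems H) \<and> \<not> F' v \<and> A' A \<noteq> SEmpty \<and> B = A' A)" for v B
    by (auto simp: elems_H' split: if_splits)
  have nbrs: "set (elems (A' A)) = {u. {v, u} \<in> edges ?G'}" if "(v, A) \<in> set (elems H)" "\<not> F' v" for v A
  proof -
    \<comment> \<open>Flags outside \<open>verts G\<close> may be set by earlier phases; because all
      neighbours lie in \<open>verts G\<close>, filtering by \<open>F'\<close> agrees with taking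
      the induced subgraph.\<close>
    have "u \<in> verts G" if "{v, u} \<in> edges G" for u
      using that G by (auto simp: simple_graph_def)
    then show ?thesis
      using represents_elem(1,3)[OF R that(1)] that(2) by (auto simp: A' F' induced_def)
  qed
  have R': "represents d ?G' H'"
    unfolding represents_def
  proof (intro conjI ballI allI)
    show "distinct (map fst (elems H'))"
      unfolding elems_H' using R
      by (intro distinct_concat_map_key[where key = fst]) (simp_all add: represents_def split: prod.split)
    show "pruned H'"
      unfolding H'_def cH_def by (intro pruned_mapreduce_sjoin) (auto simp: fH)
    have "depth H' \<le> depth D"
      unfolding H'_def cH_def by (intro depth_mapreduce_sjoin) (auto simp: fH)
    then show "depth H' \<le> d" using depth by (simp add: D)
  next
    fix x assume "x \<in> set (elems H')"
    then obtain v A where x: "x = (v, A' A)" and A: "(v, A) \<in> set (elems H)" "\<not> F' v"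
      using in_H' by (metis prod.collapse)
    show "case x of (v, B) \<Rightarrow> v \<in> verts ?G' \<and> distinct (elems B) \<and> set (elems B) = {u. {v, u} \<in> edges ?G'} \<and>
       pruned B \<and> depth B \<le> d"
      using represents_elem[OF R A(1)] nbrs[OF A] A(2) A'(2) A'(3)[of A]
      by (auto simp: x A'(1) F' induced_def)
  next
    fix v u assume v: "v \<in> verts ?G' - fst ` set (elems H')"
    then have vG: "v \<in> verts G" "\<not> F' v" by (auto simp: induced_def F')
    show "{v, u} \<notin> edges ?G'"
    proof
      assume uv: "{v, u} \<in> edges ?G'"
      then have "{v, u} \<in> edges G" by (simp add: induced_def)
      with R vG(1) have "v \<in> fst ` set (elems H)" by (auto simp: represents_def)
      then obtain A where A: "(v, A) \<in> set (elems H)" by auto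
      have "u \<in> set (elems (A' A))" using nbrs[OF A vG(2)] uv by simp
      then have "A' A \<noteq> SEmpty" by auto
      then have "(v, A' A) \<in> set (elems H')" using in_H' A vG(2) by blast
      with v show False by force
    qed
  qed
  \<comment> \<open>Only vertices with a nonempty neighbour sequence are kept, and each adds at
    least 1 to the degree sum. This bounds the next phase by its edges alone.\<close>
  have "length (elems H') \<le> 2 * card (edges ?G')"
  proof -
    have "length (elems H') = (\<Sum>x\<leftarrow>elems H'. 1)" by (simp add: sum_list_triv)
    also have "\<dots> \<le> (\<Sum>(v, A)\<leftarrow>elems H'. length (elems A))"
    proof (intro sum_list_mono)
      fix x assume "x \<in> set (elems H')"
      then obtain v A where x: "x = (v, A' A)" "A' A \<noteq> SEmpty" using in_H' by (metis prod.collapse)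
      then have "elems (A' A) \<noteq> []" using A'(2) pruned_elems_Nil by blast
      then show "1 \<le> (case x of (v, A) \<Rightarrow> length (elems A))" by (simp add: x Suc_le_eq)
    qed
    also have "\<dots> = 2 * card (edges ?G')"
      by (rule represents_sum[OF simple_graph_induced[OF G] R'])
    finally show ?thesis .
  qed
  then show "\<exists>H' F' C'. result c = Inl (H', F', C') \<and>
      represents d (cull n k G) H' \<and> length (elems H') \<le> 2 * card (edges (cull n k G)) \<and>
      set_seq C' = set_seq C \<union> heavy n k G \<and>
      (\<forall>v. F' v \<longleftrightarrow> (if v \<in> verts G then v \<in> heavy n k G else F v))"
    using R' F' X gt by (auto simp: res \<tau> \<Delta> H'_def)
qed

section \<open>The culling loop\<close>

text \<open>The body of the \<open>while\<close> inside \<open>cloop\<close> for the culling phases,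
  named so that the induction can start from arbitrary accumulated work and span.\<close>

definition phase_sum ::
  "real \<Rightarrow> ((('a \<times> 'a seq) seq \<times> ('a \<Rightarrow> bool) \<times> 'a seq) + (('a \<Rightarrow> bool) \<times> 'a seq)) \<times> nat \<times> nat \<Rightarrow>
    ((('a \<times> 'a seq) seq \<times> ('a \<Rightarrow> bool) \<times> 'a seq) + (('a \<Rightarrow> bool) \<times> 'a seq)) \<times> nat \<times> nat" where
  "phase_sum q = (\<lambda>(x, w, d). let c = phase_c q (projl x) in (result c, w + work c, d + cspan c))"

text \<open>
  The bounds distinguish whether the next phase runs, because only then is the number of edges known to
  have been halved by the preceding one.
\<close>
lemma phase_loop:
  fixes G :: "'a graph" and q :: real
  assumes n: "n \<ge> 2" and k: "k \<ge> 1" and q: "q = real k ^ 4 * log 2 n" and G: "simple_graph G"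
    and Ha: "Ha = induced G (verts G - Ca)" and Ca: "Ca \<subseteq> verts G"
    and R: "represents d Ha H" and F: "\<forall>v\<in>verts G. F v \<longleftrightarrow> v \<in> Ca" and C: "set_seq C = Ca"
  defines "e \<equiv> card (edges Ha)" and "N \<equiv> length (elems H)"
  shows "\<exists>Ca' Ha' F' C' w' s'.
    while (\<lambda>(x, w, d). isl x) (phase_sum q) (Inl (H, F, C), w, s) = (Inr (F', C'), w', s') \<and>
    while (\<lambda>(C, H). max_deg H > tau n k H) (\<lambda>(C, H). (C \<union> heavy n k H, cull n k H))
      (Ca, Ha) = (Ca', Ha') \<and>
    Ha' = induced G (verts G - Ca') \<and> Ca' \<subseteq> verts G \<and> set_seq C' = Ca' \<and>
    (\<forall>v\<in>verts G. F' v \<longleftrightarrow> v \<in> Ca') \<and> max_deg Ha' \<le> tau n k Ha' \<and>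
    w' \<le> w + (if max_deg Ha > tau n k Ha then 40 * N + 320 * e else 40 * (N + 2 * e + 1)) \<and>
    real s' \<le> s + 20 * (real d + 2) * (if max_deg Ha > tau n k Ha then log 2 e + 2 else 1) \<and>
    real (card Ca') \<le> card Ca + 4 * q * (if max_deg Ha > tau n k Ha then log 2 e + 1 else 0)"
  using Ha Ca R F C unfolding e_def N_def
\<comment> \<open>Unfolding both loops once per step gives termination and agreement of the program
  with the abstract culling in the same induction.\<close>
proof (induction "card (edges Ha)" arbitrary: Ha Ca H F C w s rule: less_induct)
  case less
  note Ha = less.prems(1) and Ca = less.prems(2) and R = less.prems(3) and F = less.prems(4) and C = less.prems(5)
  have sHa: "simple_graph Ha" unfolding Ha using G by (rule simple_graph_induced)
  have vHa: "verts Ha = verts G - Ca" by (auto simp: Ha induced_def)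
  have notF: "\<not> F v" if "v \<in> verts Ha" for v using F that by (auto simp: vHa)
  define c where "c = phase_c q (H, F, C)"
  note ph = phase_c_correct[OF n k q sHa R, of F C, folded c_def]
  have w: "work c \<le> 40 * (length (elems H) + 2 * card (edges Ha) + 1)" and s: "cspan c \<le> 20 * (d + 2)"
    using ph(1,2) notF by blast+
  have s': "real (cspan c) \<le> 20 * (real d + 2)"
    using s by simp
  let ?wc = "while (\<lambda>(x, w, d). isl x) (phase_sum q)"
  let ?wa = "while (\<lambda>(C, H). max_deg H > tau n k H) (\<lambda>(C, H). (C \<union> heavy n k H, cull n k H))"
  have unf: "?wc (Inl (H, F, C), w, s) = ?wc (result c, w + work c, s + cspan c)"
    by (subst while_unfold) (simp add: phase_sum_def c_def Let_def)
  show ?case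
  proof (cases "max_deg Ha > tau n k Ha")
    case False
    then have res: "result c = Inr (F, C)" using ph(3) notF by auto
    have "?wc (Inl (H, F, C), w, s) = (Inr (F, C), w + work c, s + cspan c)"
      unfolding unf res by (subst while_unfold) simp
    moreover have "?wa (Ca, Ha) = (Ca, Ha)"
      using False by (subst while_unfold) simp
    ultimately show ?thesis
      using False Ha Ca F C w s' by (intro exI[of _ Ca] exI[of _ Ha] exI[of _ F] exI[of _ C] exI) auto
  next
    case True
    let ?h = "heavy n k Ha" and ?H' = "cull n k Ha"
    obtain H' F' C' where res: "result c = Inl (H', F', C')"
      and R': "represents d ?H' H'" and len: "length (elems H') \<le> 2 * card (edges ?H')"
      and C': "set_seq C' = set_seq C \<union> ?h"
      and F': "\<And>v. F' v \<longleftrightarrow> (if v \<in> verts Ha then v \<in> ?h else F v)"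
      using ph(4) notF True by blast
    have hsub: "?h \<subseteq> verts Ha" by (auto simp: heavy_def)
    have fin: "finite ?h" "finite Ca"
      using hsub Ca simple_graph_finite[OF sHa] simple_graph_finite[OF G] by (auto intro: finite_subset)
    have p1: "?H' = induced G (verts G - (Ca \<union> ?h))"
      unfolding Ha induced_induced by (rule arg_cong[of _ _ "induced G"]) (auto simp: induced_def)
    have p2: "Ca \<union> ?h \<subseteq> verts G" using Ca hsub vHa by auto
    have p4: "\<forall>v\<in>verts G. F' v \<longleftrightarrow> v \<in> Ca \<union> ?h"
      using F' F hsub vHa by auto
    have p5: "set_seq C' = Ca \<union> ?h" using C C' by simp
    have less_e: "card (edges ?H') < card (edges Ha)"
      by (rule card_edges_cull_less[OF n k sHa True])
    define e e' where "e = card (edges Ha)" and "e' = card (edges ?H')"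
    have e: "e > 0" "e' < e"
      using less_e by (auto simp: e_def e'_def)
    have half: "2 * e' < e \<and> e' > 0" if "max_deg ?H' > tau n k ?H'"
      using card_edges_cull_halved[OF n k sHa that] edges_pos_if_max_deg_gt_tau[OF n k simple_graph_induced[OF sHa] that]
      by (simp add: e_def e'_def)
    have loge: "log 2 e \<ge> 0" using e by simp
    \<comment> \<open>Halving lowers the logarithm by one, which pays for the current phase both in
      the span and in the number of culled vertices.\<close>
    have logh: "log 2 e' + 1 \<le> log 2 e" if "max_deg ?H' > tau n k ?H'"
    proof -
      have "log 2 (2 * real e') \<le> log 2 (real e)"
        using half[OF that] by (intro log_mono) auto
      moreover have "log 2 (2 * real e') = 1 + log 2 e'"
        using half[OF that] by (subst log_mult) auto
      ultimately show ?thesis by simp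
    qed
    obtain Ca2 Ha2 F2 C2 w2 s2 where
      IH1: "?wc (Inl (H', F', C'), w + work c, s + cspan c) = (Inr (F2, C2), w2, s2)"
      and IH2: "?wa (Ca \<union> ?h, ?H') = (Ca2, Ha2)"
      and IH3: "Ha2 = induced G (verts G - Ca2)" "Ca2 \<subseteq> verts G" "set_seq C2 = Ca2"
        "\<forall>v\<in>verts G. F2 v \<longleftrightarrow> v \<in> Ca2" "max_deg Ha2 \<le> tau n k Ha2"
      and IHw: "w2 \<le> w + work c + (if max_deg ?H' > tau n k ?H' then 40 * length (elems H') + 320 * e'
          else 40 * (length (elems H') + 2 * e' + 1))"
      and IHs: "real s2 \<le> real (s + cspan c) + 20 * (real d + 2) * (if max_deg ?H' > tau n k ?H' then log 2 e' + 2 else 1)"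
      and IHc: "real (card Ca2) \<le> card (Ca \<union> ?h) + 4 * q * (if max_deg ?H' > tau n k ?H' then log 2 e' + 1 else 0)"
      using less.hyps[OF less_e p1 p2 R' p4 p5, of "w + work c" "s + cspan c", folded e'_def]
      by (elim exE conjE) (rule that; assumption)
    have "?wc (Inl (H, F, C), w, s) = (Inr (F2, C2), w2, s2)"
      unfolding unf res by (rule IH1)
    moreover have "?wa (Ca, Ha) = (Ca2, Ha2)"
      using True IH2 by (subst while_unfold) simp
    \<comment> \<open>Besides \<open>40 * length (elems H)\<close> the current phase costs
      \<open>80 * e + 40\<close>. If another phase runs, the rest is at most
      \<open>400 * e'\<close>, below \<open>200 * e\<close>; otherwise the final test costs at most
      \<open>160 * e' + 40\<close>, below \<open>160 * e\<close> because \<open>e' < e\<close>.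
      Hence 320 suffices.\<close>
    moreover have "w2 \<le> w + (40 * length (elems H) + 320 * e)"
    proof -
      have len': "length (elems H') \<le> 2 * e'" using len by (simp add: e'_def)
      have w': "work c \<le> 40 * (length (elems H) + 2 * e + 1)" using w by (simp add: e_def)
      show ?thesis
      proof (cases "max_deg ?H' > tau n k ?H'")
        case True
        then show ?thesis using IHw half len' w' e by simp
      next
        case False
        then show ?thesis using IHw len' w' e by simp
      qed
    qed
    moreover have "real s2 \<le> s + 20 * (real d + 2) * (log 2 e + 2)"
    proof -
      define P where "P = 20 * (real d + 2)"
      have P: "P \<ge> 0" by (simp add: P_def)
      have "real s2 \<le> real s + P + P * (if max_deg ?H' > tau n k ?H' then log 2 e' + 2 else 1)"
        using IHs s' by (simp add: P_def)
      also have "\<dots> \<le> real s + P + P * (log 2 e + 1)"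
        using logh loge P by (intro add_left_mono mult_left_mono) auto
      finally show ?thesis by (simp add: P_def algebra_simps)
    qed
    moreover have "real (card Ca2) \<le> card Ca + 4 * q * (log 2 e + 1)"
    proof -
      have q0: "q > 0" unfolding q by (rule quota_pos[OF n k])
      have "card (Ca \<union> ?h) \<le> card Ca + card ?h" by (rule card_Un_le)
      then have "real (card (Ca \<union> ?h)) \<le> card Ca + 4 * q"
        using card_heavy_le[OF n k sHa True] unfolding q by linarith
      with IHc have "real (card Ca2) \<le> card Ca + 4 * q + 4 * q * (if max_deg ?H' > tau n k ?H' then log 2 e' + 1 else 0)"
        by linarith
      also have "\<dots> \<le> card Ca + 4 * q + 4 * q * log 2 e"
        using logh loge q0 by (intro add_left_mono mult_left_mono) auto
      finally show ?thesis by (simp add: algebra_simps)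
    qed
    ultimately show ?thesis
      using IH3 True unfolding e_def
      by (intro exI[of _ Ca2] exI[of _ Ha2] exI[of _ F2] exI[of _ C2] exI[of _ w2] exI[of _ s2]) simp
  qed
qed

lemma adjacency_represents:
  assumes G: "simple_graph G" and adj: "adjacency_arrays G vs adj" and d: "card (verts G) \<le> 2 ^ d"
  shows "represents d G (map_seq (\<lambda>v. (v, result (of_array (adj v)))) (result (of_array vs)))"
proof -
  have vs: "distinct vs" "set vs = verts G" "length vs \<le> 2 ^ d"
    using adj d distinct_card[of vs] by (auto simp: adjacency_arrays_def)
  have len: "length (adj v) \<le> 2 ^ d" if "v \<in> verts G" for v
  proof -
    have "length (adj v) = card {u. {v, u} \<in> edges G}"
      using adj that distinct_card[of "adj v"] by (simp add: adjacency_arrays_def)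
    also have "\<dots> \<le> card (verts G)"
      using G by (intro card_mono) (auto simp: simple_graph_def)
    finally show ?thesis using d by simp
  qed
  show ?thesis
    unfolding represents_def
    using of_array_costs[of vs d] of_array_costs[of "adj v" d for v] vs len adj
    by (auto simp: comp_def adjacency_arrays_def image_image)
qed

text \<open>Isolated vertices are listed only on entry to the loop, so \<open>n\<close> enters the
  work once rather than once per phase.\<close>

theorem stage_I_c_correct:
  fixes G :: "'a graph"
  assumes G: "simple_graph G" and adj: "adjacency_arrays G vs adj" and k: "k \<ge> 1"
    and n: "n = card (verts G)" "n \<ge> 2" and d: "n \<le> 2 ^ d"
  defines "m \<equiv> card (edges G)" and "c \<equiv> stage_I_c vs adj k" and "Ca \<equiv> stage_I G k"
  defines "H \<equiv> induced G (verts G - Ca)" and "q \<equiv> real k ^ 4 * log 2 n"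
  shows "Ca \<subseteq> verts G" "set_seq (snd (result c)) = Ca"
    "\<And>v. v \<in> verts G \<Longrightarrow> fst (result c) v \<longleftrightarrow> v \<in> Ca"
    "max_deg H \<le> tau n k H"
    "work c \<le> 400 * (n + m + 1)"
    "real (cspan c) \<le> 80 * (real d + 2) * (log 2 n + 2)"
    "real (card Ca) \<le> 4 * q * (2 * log 2 n + 1)"
proof -
  have vs: "distinct vs" "set vs = verts G" and lenvs: "length vs = n"
    using adj distinct_card[of vs] n by (auto simp: adjacency_arrays_def)
  define T where "T = result (of_array vs)"
  have T: "elems T = vs" "pruned T" "depth T \<le> d" "leaves T \<le> n + 1"
    using of_array_costs[of vs d] d leaves_pruned[of T] by (auto simp: T_def lenvs)
  have adj_len: "length (adj v) = deg G v" if "v \<in> verts G" for v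
    using adj that distinct_card[of "adj v"] by (simp add: adjacency_arrays_def deg_eq_card_neighbours[OF G])
  have adj_d: "length (adj v) \<le> 2 ^ d" if "v \<in> verts G" for v
  proof -
    have "length (adj v) \<le> card (verts G)"
      using G that unfolding adj_len[OF that] deg_eq_card_neighbours[OF G]
      by (intro card_mono) (auto simp: simple_graph_def)
    then show ?thesis using d n by simp
  qed
  define Z where "Z = map_seq (\<lambda>v. (v, False)) T"
  define F where "F = result (par_write (\<lambda>_. undefined) Z)"
  define fH where "fH = (\<lambda>v. do { A \<leftarrow> of_array (adj v); unit_op (v, A) })"
  define H0 where "H0 = map_seq (\<lambda>v. (v, result (of_array (adj v)))) T"
  define cF where "cF = par_write (\<lambda>_. undefined) Z"
  define cZ where "cZ = smap (\<lambda>v. unit_op (v, False)) T"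
  define cH where "cH = smap fH T"
  define cl where "cl = cloop (phase_c q) (H0, F, SEmpty)"
  have resH: "result cH = H0" by (simp add: cH_def H0_def fH_def)
  have resZ: "result cZ = Z" by (simp add: cZ_def Z_def)
  have q': "real k * real k * (real k * real k) * log 2 (real n) = q"
    by (simp add: q_def eval_nat_numeral)
  have c: "c = do { T \<leftarrow> of_array vs;
     n \<leftarrow> scount T;
     k2 \<leftarrow> unit_op (real k * real k);
     k4 \<leftarrow> unit_op (k2 * k2);
     l \<leftarrow> unit_op (log 2 (real n));
     q \<leftarrow> unit_op (k4 * l);
     Z \<leftarrow> smap (\<lambda>v. unit_op (v, False)) T;
     F \<leftarrow> par_write (\<lambda>_. undefined) Z;
     H \<leftarrow> smap fH T;
     cloop (phase_c q) (H, F, SEmpty) }"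
    by (simp add: c_def stage_I_c_def fH_def)
  have cl': "cloop (phase_c (real k * real k * (real k * real k) * log 2 (real (length (elems (result (of_array vs)))))))
     (result (smap fH (result (of_array vs))), result (par_write (\<lambda>_. undefined) (result (smap (\<lambda>v. unit_op (v, False)) (result (of_array vs))))), SEmpty) = cl"
    unfolding T_def[symmetric] T lenvs q' cl_def cH_def[symmetric] cZ_def[symmetric] resH resZ F_def ..
  have res: "result c = result cl"
    unfolding c by (simp only: costed_cbind costed_unit_op result_scount cl')
  have wk: "work c = work (of_array vs) + work (scount T) + 4 + work cZ + work cF + work cH + work cl"
    unfolding c by (simp only: costed_cbind costed_unit_op result_scount cl')
      (simp add: T_def cZ_def cF_def cH_def Z_def)
  have sp: "cspan c = cspan (of_array vs) + cspan (scount T) + 4 + cspan cZ + cspan cF + cspan cH + cspan cl"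
    unfolding c by (simp only: costed_cbind costed_unit_op result_scount cl')
      (simp add: T_def cZ_def cF_def cH_def Z_def)
  \<comment> \<open>The memory starts as \<open>undefined\<close>; the initial writes are what
    clears the flags of all vertices.\<close>
  have F: "\<forall>v\<in>verts G. F v \<longleftrightarrow> v \<in> {}"
  proof
    fix v assume v: "v \<in> verts G"
    have "(v, False) \<in> set (elems Z)" "distinct (map fst (elems Z))"
      using v vs by (auto simp: Z_def T comp_def)
    then show "F v \<longleftrightarrow> v \<in> {}"
      unfolding F_def result_par_write by (simp add: fold_fun_upd_in)
  qed
  have R: "represents d G H0"
    unfolding H0_def T_def using adjacency_represents[OF G adj] d n by simp
  have lenH0: "length (elems H0) = n" by (simp add: H0_def T lenvs)
  obtain Ca' Ha' F' C' w' s' where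
    L1: "while (\<lambda>(x, w, d). isl x) (phase_sum q) (Inl (H0, F, SEmpty), 0, 0) = (Inr (F', C'), w', s')"
    and L2: "while (\<lambda>(C, H). max_deg H > tau n k H) (\<lambda>(C, H). (C \<union> heavy n k H, cull n k H)) ({}, G) = (Ca', Ha')"
    and L3: "Ha' = induced G (verts G - Ca')" "Ca' \<subseteq> verts G" "set_seq C' = Ca'"
       "\<forall>v\<in>verts G. F' v \<longleftrightarrow> v \<in> Ca'" "max_deg Ha' \<le> tau n k Ha'"
    and Lw: "w' \<le> (if max_deg G > tau n k G then 40 * n + 320 * m else 40 * (n + 2 * m + 1))"
    and Ls: "real s' \<le> 20 * (real d + 2) * (if max_deg G > tau n k G then log 2 m + 2 else 1)"
    and Lc: "real (card Ca') \<le> 4 * q * (if max_deg G > tau n k G then log 2 m + 1 else 0)"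
  proof -
    have "G = induced G (verts G - {})" "{} \<subseteq> verts G" "set_seq SEmpty = {}"
      using induced_verts[OF G] by auto
    from phase_loop[OF n(2) k q_def[THEN meta_eq_to_obj_eq] G this(1,2) R F this(3), where w = 0 and s = 0,
        folded m_def, unfolded lenH0 add_0 card.empty of_nat_0]
    show ?thesis by (elim exE conjE) (rule that; assumption)
  qed
  have Ca: "Ca = Ca'"
    unfolding Ca_def stage_I_def Let_def n(1)[symmetric] L2 by simp
  have cl: "cl = Costed (F', C') w' s'"
    using L1 unfolding cl_def cloop_def phase_sum_def by simp
  show "Ca \<subseteq> verts G" "set_seq (snd (result c)) = Ca"
    "\<And>v. v \<in> verts G \<Longrightarrow> fst (result c) v \<longleftrightarrow> v \<in> Ca"
    "max_deg H \<le> tau n k H"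
    using L3 by (auto simp: Ca res cl H_def)
  have logn: "log 2 n \<ge> 1" using log_ge_1[OF n(2) k] .
  have logm: "log 2 m \<le> 2 * log 2 n" if "m > 0"
  proof -
    have "real m \<le> real n ^ 2"
      using card_edges_le[OF G] unfolding m_def n(1) by (metis of_nat_le_iff of_nat_power)
    then have "log 2 m \<le> log 2 (real n ^ 2)" using that by (intro log_mono) auto
    then show ?thesis using n by (simp add: log_nat_power)
  qed
  have q0: "q > 0" unfolding q_def by (rule quota_pos[OF n(2) k])
  have mpos: "m > 0" if "max_deg G > tau n k G"
    unfolding m_def by (rule edges_pos_if_max_deg_gt_tau[OF n(2) k G that])
  have "4 * q * (if max_deg G > tau n k G then log 2 m + 1 else 0) \<le> 4 * q * (2 * log 2 n + 1)"
    using logm mpos logn q0 by (intro mult_left_mono) auto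
  then show "real (card Ca) \<le> 4 * q * (2 * log 2 n + 1)"
    using Lc unfolding Ca by linarith
  have w1: "work (of_array vs) \<le> 3 * n"
    using of_array_costs[of vs d] n(2) by (auto simp: lenvs)
  have w2: "work (scount T) \<le> n + 3 * (n + 1)"
    using work_scount[of T] T by (simp add: lenvs)
  have w3: "work cZ \<le> 2 * n + 3 * (n + 1)"
    using work_smap[of "\<lambda>v. unit_op (v, False)" T] T by (simp add: cZ_def sum_list_triv lenvs)
  have w4: "work cF \<le> 2 * (n + 1)"
    using work_par_write[of "\<lambda>_. undefined" Z] T by (simp add: cF_def Z_def)
  have w5: "work cH \<le> 6 * m + 3 * n + 3 * (n + 1)"
  proof -
    have "(\<Sum>v\<leftarrow>vs. work (fH v) + 1) \<le> (\<Sum>v\<leftarrow>vs. 3 * deg G v + 3)"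
    proof (rule sum_list_mono)
      fix v assume "v \<in> set vs"
      then show "work (fH v) + 1 \<le> 3 * deg G v + 3"
        using of_array_costs[of "adj v" 0] adj_len[of v] vs by (auto simp: fH_def max_def split: if_splits)
    qed
    also have "\<dots> = 3 * (\<Sum>v\<in>verts G. deg G v) + 3 * n"
      using vs by (simp add: sum_list_addf sum_list_const_mult sum_list_triv lenvs sum_list_distinct_conv_sum_set)
    finally show ?thesis
      using work_smap[of fH T] T by (simp add: cH_def handshake[OF G] m_def)
  qed
  show "work c \<le> 400 * (n + m + 1)"
    unfolding wk using w1 w2 w3 w4 w5 Lw by (auto simp: cl split: if_splits)
  have s1: "cspan (of_array vs) \<le> 2 * d + 1"
    using of_array_costs[of vs d] d by (auto simp: lenvs)
  have s2: "cspan (scount T) \<le> 2 * d + 2"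
    using cspan_scount[of T] T by simp
  have s3: "cspan cZ \<le> 2 * d + 3"
    using cspan_smap[of T "\<lambda>v. unit_op (v, False)" 1] T by (simp add: cZ_def)
  have s4: "cspan cF \<le> d + 1"
    using cspan_par_write[of "\<lambda>_. undefined" Z] T by (simp add: cF_def Z_def)
  have s5: "cspan cH \<le> 4 * d + 4"
  proof -
    have "cspan (fH v) \<le> 2 * d + 2" if "v \<in> set (elems T)" for v
      using of_array_costs[of "adj v" d] adj_d[of v] vs that by (auto simp: fH_def T)
    then show ?thesis using cspan_smap[of T fH "2 * d + 2"] T by (simp add: cH_def)
  qed
  have "real s' \<le> 20 * (real d + 2) * (2 * log 2 n + 2)"
  proof -
    have "20 * (real d + 2) * (if max_deg G > tau n k G then log 2 m + 2 else 1) \<le> 20 * (real d + 2) * (2 * log 2 n + 2)"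
      using logm mpos logn by (intro mult_left_mono) auto
    with Ls show ?thesis by (rule order_trans)
  qed
  \<comment> \<open>The preprocessing is no deeper than the bound for one phase, so it is charged as
    one more phase.\<close>
  moreover have "real (cspan c) \<le> 20 * (real d + 2) + real s'"
    unfolding sp using s1 s2 s3 s4 s5 by (simp add: cl)
  ultimately have "real (cspan c) \<le> 20 * (real d + 2) * (2 * log 2 n + 3)"
    by (simp add: algebra_simps)
  also have "\<dots> \<le> 20 * (real d + 2) * (4 * (log 2 n + 2))"
    using logn by (intro mult_left_mono) auto
  also have "\<dots> = 80 * (real d + 2) * (log 2 n + 2)" by (simp add: algebra_simps)
  finally show "real (cspan c) \<le> 80 * (real d + 2) * (log 2 n + 2)" by simp
qed

section \<open>Distribution to the buckets\<close>

lemma fill_costs [simp]: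
  "result (fill k) = replicate k SEmpty" "work (fill k) = k + 1" "cspan (fill k) = k + 1"
  by (induction k) auto

text \<open>Five operations per vertex: reading the flag, drawing, reading the bucket, appending,
  and writing it back.\<close>

lemma work_insert_block: "work (insert_block F \<omega> xs B) \<le> 5 * length xs + 1"
proof (induction xs arbitrary: B)
  case (Cons v xs)
  show ?case
    using Cons.IH[of B] Cons.IH[of "B[\<omega> v := sjoin (B ! \<omega> v) (SOne v)]"] by auto
qed simp

lemma cspan_insert_block: "cspan (insert_block F \<omega> xs B) \<le> 5 * length xs + 1"
proof (induction xs arbitrary: B)
  case (Cons v xs)
  show ?case
    using Cons.IH[of B] Cons.IH[of "B[\<omega> v := sjoin (B ! \<omega> v) (SOne v)]"] by auto
qed simp

lemma result_insert_block:
  assumes "length B = k" "\<And>v. v \<in> set xs \<Longrightarrow> \<not> F v \<Longrightarrow> \<omega> v < k"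
  shows "length (result (insert_block F \<omega> xs B)) = k \<and>
    (\<forall>i<k. set_seq (result (insert_block F \<omega> xs B) ! i) = set_seq (B ! i) \<union> {v \<in> set xs. \<not> F v \<and> \<omega> v = i})"
  using assms
proof (induction xs arbitrary: B)
  case (Cons v xs)
  show ?case
  proof (cases "F v")
    case True
    then show ?thesis using Cons.IH[of B] Cons.prems by auto
  next
    case False
    let ?B = "B[\<omega> v := sjoin (B ! \<omega> v) (SOne v)]"
    have "\<omega> v < k" using Cons.prems False by auto
    then show ?thesis
      using False Cons.IH[of ?B] Cons.prems by (auto simp: nth_list_update)
  qed
qed simp

lemma merge_buckets_costs:
  assumes "length B = k" "length B' = k"
  shows "length (result (merge_buckets B B')) = k \<and>
    (\<forall>i<k. set_seq (result (merge_buckets B B') ! i) = set_seq (B ! i) \<union> set_seq (B' ! i)) \<and>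
    work (merge_buckets B B') = 2 * k + 1 \<and> cspan (merge_buckets B B') = 2 * k + 1"
  using assms
proof (induction k arbitrary: B B')
  case (Suc k)
  then obtain s C t C' where "B = s # C" "B' = t # C'" "length C = k" "length C' = k"
    by (metis length_Suc_conv)
  then show ?case using Suc.IH[of C C'] by (auto simp: nth_Cons split: nat.splits)
qed simp

text \<open>
  Every block of a proper subdivision has at least \<open>k / 2\<close> elements, and can therefore save a credit of
  \<open>4 k\<close>, from which the merging of two blocks is paid. The weaker bound also covers a single short block.
\<close>
lemma distribute_costs:
  assumes k: "k \<ge> 1" and "\<forall>v\<in>set xs. \<not> F v \<longrightarrow> \<omega> v < k"
  shows "length (result (distribute F \<omega> k xs)) = k \<and>
    (\<forall>i<k. set_seq (result (distribute F \<omega> k xs) ! i) = {v \<in> set xs. \<not> F v \<and> \<omega> v = i}) \<and>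
    work (distribute F \<omega> k xs) \<le> 17 * length xs + k + 2 \<and>
    (k \<le> 2 * length xs \<longrightarrow> work (distribute F \<omega> k xs) + 4 * k \<le> 17 * length xs) \<and>
    (length xs \<le> 2 ^ d \<longrightarrow> cspan (distribute F \<omega> k xs) \<le> 6 * k + 2 + d * (2 * k + 2))"
  using assms(2)
proof (induction "length xs" arbitrary: xs d rule: less_induct)
  case less
  show ?case
  proof (cases "length xs \<le> k")
    case True
    then have eq: "distribute F \<omega> k xs = cbind (fill k) (insert_block F \<omega> xs)"
      using k by (subst distribute.simps) auto
    let ?I = "insert_block F \<omega> xs (replicate k SEmpty)"
    have costs: "work ?I \<le> 5 * length xs + 1" "cspan ?I \<le> 5 * length xs + 1"
      by (rule work_insert_block, rule cspan_insert_block)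
    have res: "length (result ?I) = k \<and> (\<forall>i<k. set_seq (result ?I ! i) = {v \<in> set xs. \<not> F v \<and> \<omega> v = i})"
      using result_insert_block[of "replicate k SEmpty" k xs F \<omega>] less.prems by auto
    \<comment> \<open>Origin of the 17: with the credit \<open>4 * k\<close>, a block costs
      \<open>5 * k + 2 + 5 * length xs\<close>. Here \<open>k\<close> is at most twice the length,
      and the 2 is covered because the block is nonempty.\<close>
    have "5 * k + 2 + 5 * length xs \<le> 17 * length xs" if "k \<le> 2 * length xs"
      using that k by presburger
    then have "work (distribute F \<omega> k xs) + 4 * k \<le> 17 * length xs" if "k \<le> 2 * length xs"
      using that costs by (simp add: eq)
    moreover have "work (distribute F \<omega> k xs) \<le> 17 * length xs + k + 2"
      using costs by (simp add: eq)
    moreover have "cspan (distribute F \<omega> k xs) \<le> 6 * k + 2 + d * (2 * k + 2)"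
      using costs True by (simp add: eq)
    ultimately show ?thesis using res by (simp add: eq)
  next
    case False
    define h where "h = length xs div 2"
    let ?l = "distribute F \<omega> k (take h xs)" and ?r = "distribute F \<omega> k (drop h xs)"
    have eq: "distribute F \<omega> k xs = cbind (fork ?l ?r) (\<lambda>(B, B'). merge_buckets B B')"
      using False k by (subst distribute.simps) (auto simp: h_def Let_def)
    \<comment> \<open>Splitting happens only above length \<open>k\<close>, so even the shorter half
      retains \<open>k / 2\<close> elements and earns its credit.\<close>
    have h: "h < length xs" "h > 0" "k \<le> 2 * h" "k \<le> 2 * (length xs - h)"
      using False k by (auto simp: h_def)
    have len: "length (take h xs) = h" "length (drop h xs) = length xs - h"
      using h by auto
    have P: "\<forall>v\<in>set (take h xs). \<not> F v \<longrightarrow> \<omega> v < k" "\<forall>v\<in>set (drop h xs). \<not> F v \<longrightarrow> \<omega> v < k"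
      using less.prems by (auto dest: in_set_takeD in_set_dropD)
    have sets: "set xs = set (take h xs) \<union> set (drop h xs)"
      by (metis append_take_drop_id set_append)
    note L = less.hyps[of "take h xs", OF _ P(1), unfolded len]
      and R = less.hyps[of "drop h xs", OF _ P(2), unfolded len]
    have resL: "length (result ?l) = k" "\<forall>i<k. set_seq (result ?l ! i) = {v \<in> set (take h xs). \<not> F v \<and> \<omega> v = i}"
      "work ?l + 4 * k \<le> 17 * h"
      using L h by auto
    have resR: "length (result ?r) = k" "\<forall>i<k. set_seq (result ?r ! i) = {v \<in> set (drop h xs). \<not> F v \<and> \<omega> v = i}"
      "work ?r + 4 * k \<le> 17 * (length xs - h)"
      using R h by auto
    note M = merge_buckets_costs[OF resL(1) resR(1)]
    have "work (distribute F \<omega> k xs) + 4 * k \<le> 17 * length xs"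
      unfolding eq using resL(3) resR(3) M k h by simp
    moreover have "cspan (distribute F \<omega> k xs) \<le> 6 * k + 2 + d * (2 * k + 2)" if len_d: "length xs \<le> 2 ^ d"
    proof -
      obtain d' where d': "d = Suc d'"
        using len_d False k by (cases d) auto
      have "h \<le> 2 ^ d'" "length xs - h \<le> 2 ^ d'"
        using len_d d' by (auto simp: h_def)
      then have "cspan ?l \<le> 6 * k + 2 + d' * (2 * k + 2)" "cspan ?r \<le> 6 * k + 2 + d' * (2 * k + 2)"
        using L[of d'] R[of d'] h by auto
      then show ?thesis unfolding eq using M by (auto simp: d')
    qed
    moreover have "length (result (distribute F \<omega> k xs)) = k \<and>
      (\<forall>i<k. set_seq (result (distribute F \<omega> k xs) ! i) = {v \<in> set xs. \<not> F v \<and> \<omega> v = i})"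
      unfolding eq sets using M resL(2) resR(2) by auto
    ultimately show ?thesis by auto
  qed
qed

section \<open>Assembly of the two stages and choice of the constants\<close>

text \<open>Makes a polylogarithmic \<open>k\<close> at most linear in \<open>n\<close>, both for
  the work spent on \<open>k\<close> buckets and for the union bound over them.\<close>

lemma log_power_le_linear:
  "\<exists>M\<ge>1. \<forall>n\<ge>(2::nat). log 2 (real n) ^ c \<le> M * real n"
proof (intro exI conjI allI impI)
  let ?M = "1 + (real c / ln 2) ^ c"
  show "1 \<le> ?M" by simp
  fix n :: nat assume n: "n \<ge> 2"
  show "log 2 (real n) ^ c \<le> ?M * real n"
  proof (cases "c = 0")
    case False
    have ln: "ln (real n) \<ge> 0" using n by simp
    have "(ln n / c) ^ c \<le> (1 + ln n / c) ^ c"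
      using ln by (intro power_mono) auto
    \<comment> \<open>The inequality \<open>(1 + x / c) ^ c\<close> at most \<open>exp x\<close>,
      taken at \<open>x = ln n\<close>, gives an explicit constant valid for all
      \<open>n\<close>.\<close>
    also have "\<dots> \<le> exp (ln n)"
      using ln False by (intro exp_ge_one_plus_x_over_n_power_n) auto
    also have "\<dots> = n" using n by simp
    finally have le: "(ln n / c) ^ c \<le> n" .
    have "log 2 (real n) = (c / ln 2) * (ln n / c)"
      using False by (simp add: log_def)
    then have "log 2 (real n) ^ c = (c / ln 2) ^ c * (ln n / c) ^ c"
      by (simp only: power_mult_distrib)
    also have "\<dots> \<le> (c / ln 2) ^ c * n"
      using le by (intro mult_left_mono) auto
    also have "\<dots> \<le> ?M * n" by (intro mult_right_mono) auto
    finally show ?thesis .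
  qed (use n in simp)
qed

text \<open>The culling is deterministic, so the randomness is a single assignment
  \<open>\<omega>\<close> of the remaining vertices and a run is a function of it. The cost bounds
  hold for every \<open>\<omega>\<close> in the support.\<close>

lemma stages_c_run:
  fixes G :: "'a graph"
  assumes G: "simple_graph G" and adj: "adjacency_arrays G vs adj" and k: "k \<ge> 1"
    and n: "n = card (verts G)" "n \<ge> 2" and d: "n \<le> 2 ^ d"
  defines "m \<equiv> card (edges G)" and "Ca \<equiv> stage_I G k"
  defines "P \<equiv> Pi_pmf (verts G - Ca) 0 (\<lambda>_. pmf_of_set {..<k})"
  shows "\<exists>run. stages_c vs adj k = map_pmf run P \<and> (\<forall>\<omega>\<in>set_pmf P.
    run_output (run \<omega>) = (Ca, map (\<lambda>i. {v \<in> verts G - Ca. \<omega> v = i}) [0..<k]) \<and>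
    work (run \<omega>) \<le> 400 * (n + m + 1) + 17 * n + k + 2 \<and>
    real (cspan (run \<omega>)) \<le> 80 * (real d + 2) * (log 2 n + 2) + 6 * real k + 2 + real d * (2 * real k + 2))"
proof -
  define c where "c = stage_I_c vs adj k"
  define F C where "F = fst (result c)" and "C = snd (result c)"
  note S = stage_I_c_correct[OF G adj k n d, folded m_def c_def Ca_def, folded F_def C_def]
  have vs: "set vs = verts G" "length vs = n"
    using adj distinct_card[of vs] n by (auto simp: adjacency_arrays_def)
  define run where "run = (\<lambda>\<omega>. do { (F, C) \<leftarrow> c; B \<leftarrow> distribute F \<omega> k vs; ret (C, B) })"
  have FC: "result c = (F, C)" by (simp add: F_def C_def)
  \<comment> \<open>The program draws for the unflagged vertices; correctness of the flags
    identifies this domain with that of the abstract second stage.\<close>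
  have dom: "{v \<in> set vs. \<not> F v} = verts G - Ca"
    using S(3) vs by auto
  have r1: "stages_c vs adj k = map_pmf run P"
    unfolding stages_c_def c_def[symmetric] Let_def run_def P_def FC prod.case dom ..
  have supp: "\<forall>v\<in>set vs. \<not> F v \<longrightarrow> \<omega> v < k" if "\<omega> \<in> set_pmf P" for \<omega>
  proof (intro ballI impI)
    fix v assume "v \<in> set vs" "\<not> F v"
    then have "v \<in> verts G - Ca" using dom by blast
    moreover have "finite (verts G - Ca)" "{..<k} \<noteq> {}"
      using simple_graph_finite[OF G] k by (auto simp: lessThan_empty_iff)
    ultimately show "\<omega> v < k"
      using that by (auto simp: P_def set_Pi_pmf PiE_dflt_def)
  qed
  note D = distribute_costs[OF k supp, of _ d]
  have r2: "run_output (run \<omega>) = (Ca, map (\<lambda>i. {v \<in> verts G - Ca. \<omega> v = i}) [0..<k])"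
    if "\<omega> \<in> set_pmf P" for \<omega>
  proof -
    have "{v \<in> set vs. \<not> F v \<and> \<omega> v = i} = {v \<in> verts G - Ca. \<omega> v = i}" for i
      using dom by blast
    then have "map set_seq (result (distribute F \<omega> k vs)) = map (\<lambda>i. {v \<in> verts G - Ca. \<omega> v = i}) [0..<k]"
      using D[OF that] by (intro nth_equalityI) auto
    then show ?thesis using S(2) by (simp add: run_output_def run_def FC)
  qed
  have r3: "work (run \<omega>) \<le> 400 * (n + m + 1) + 17 * n + k + 2" if "\<omega> \<in> set_pmf P" for \<omega>
    using D[OF that] S(5) by (simp add: run_def FC vs)
  have r4: "real (cspan (run \<omega>)) \<le> 80 * (real d + 2) * (log 2 n + 2) + 6 * real k + 2 + real d * (2 * real k + 2)"
    if "\<omega> \<in> set_pmf P" for \<omega>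
  proof -
    have "cspan (distribute F \<omega> k vs) \<le> 6 * k + 2 + d * (2 * k + 2)"
      using D[OF that] d vs by blast
    then have "real (cspan (distribute F \<omega> k vs)) \<le> real (6 * k + 2 + d * (2 * k + 2))"
      by (rule of_nat_mono)
    then show ?thesis using S(6) by (simp add: run_def FC algebra_simps)
  qed
  show ?thesis using r1 r2 r3 r4 by blast
qed

text \<open>The first stage enters only through the exit condition of its loop and the size of
  \<open>Ca\<close>. The tail bound refers to the culled graph, whose edge number is at most that of
  \<open>G\<close>.\<close>

lemma buckets_balanced:
  fixes G :: "'a graph" and r :: real
  assumes G: "simple_graph G" and k: "k \<ge> 1" and n: "n = card (verts G)" "n \<ge> 2"
    and Ca: "Ca \<subseteq> verts G" "max_deg (induced G (verts G - Ca)) \<le> tau n k (induced G (verts G - Ca))"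
    and card_Ca: "real (card Ca) \<le> B * log 2 n ^ b" and r: "r > 0"
  defines "P \<equiv> Pi_pmf (verts G - Ca) 0 (\<lambda>_. pmf_of_set {..<k})"
  shows "measure_pmf.prob P
    {\<omega>. \<not> culled_balanced_partition B b (1 + r) G k (Ca, map (\<lambda>i. {v \<in> verts G - Ca. \<omega> v = i}) [0..<k])}
    \<le> k * real n powr - r\<^sup>2"
proof -
  let ?H = "induced G (verts G - Ca)"
  let ?V = "\<lambda>\<omega> i. {v \<in> verts G - Ca. \<omega> v = i}"
  define bad where
    "bad = (\<lambda>i. {\<omega>. real (card (mono_edges ?H \<omega> i)) > (1 + r) * (card (edges ?H) / (real k)\<^sup>2)})"
  have H: "simple_graph ?H" using G by (rule simple_graph_induced)
  have vH: "verts ?H = verts G - Ca" by (auto simp: induced_def)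
  have fin: "finite (verts G - Ca)" using simple_graph_finite[OF G] by auto
  have "culled_balanced_partition B b (1 + r) G k (Ca, map (?V \<omega>) [0..<k])"
    if \<omega>: "\<omega> \<in> set_pmf P" and good: "\<omega> \<notin> (\<Union>i<k. bad i)" for \<omega>
  proof -
    have "{..<k} \<noteq> {}" using k by (auto simp: lessThan_empty_iff)
    then have range: "\<omega> v < k" if "v \<in> verts G - Ca" for v
      using \<omega> fin that by (auto simp: P_def set_Pi_pmf PiE_dflt_def)
    have bal: "real (card (edges (induced G (?V \<omega> i)))) \<le> (1 + r) * (card (edges G) / k\<^sup>2)" if i: "i < k" for i
    proof -
      \<comment> \<open>No bucket meets \<open>Ca\<close>, so the edges inside a bucket are already
        edges of the culled graph.\<close>
      have "edges (induced G (?V \<omega> i)) = mono_edges ?H \<omega> i"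
        by (auto simp: induced_def mono_edges_def)
      then have "real (card (edges (induced G (?V \<omega> i)))) \<le> (1 + r) * (card (edges ?H) / (real k)\<^sup>2)"
        using good i by (auto simp: bad_def not_less)
      also have "\<dots> \<le> (1 + r) * (card (edges G) / (real k)\<^sup>2)"
        using r simple_graph_finite[OF G]
        by (intro mult_left_mono divide_right_mono of_nat_mono card_mono) (auto simp: induced_def)
      finally show ?thesis by simp
    qed
    have "(\<Union>i<k. ?V \<omega> i) = verts G - Ca" using range by auto
    then show ?thesis
      using Ca(1) card_Ca bal n(1)
      by (auto simp: culled_balanced_partition_def disjoint_family_on_def)
  qed
  then have "measure_pmf.prob P {\<omega>. \<not> culled_balanced_partition B b (1 + r) G k (Ca, map (?V \<omega>) [0..<k])}
      \<le> measure_pmf.prob P (\<Union>i<k. bad i)"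
    by (intro measure_pmf.finite_measure_mono_AE) (auto simp: AE_measure_pmf_iff)
  also have "\<dots> \<le> (\<Sum>i<k. measure_pmf.prob P (bad i))"
    by (intro measure_pmf.finite_measure_subadditive_finite) auto
  also have "\<dots> \<le> (\<Sum>i<k. real n powr - r\<^sup>2)"
    using mono_edges_tail[OF H _ n(2) Ca(2) r] unfolding bad_def P_def vH by (intro sum_mono) auto
  finally show ?thesis by simp
qed

text \<open>The constants precede the graph and depend only on the bound for \<open>k\<close>, so
  every O is uniform. Equality of distributions ties the costed program to the abstract stages, and
  balance and work form one joint event over its runs.\<close>

theorem theorem4p5:
  fixes a :: real and c :: nat
  shows "\<exists>(B::real) (b::nat) (K::real) (W::real) (S::real) (s::nat) (d::real). d > 0 \<and>
    (\<forall>(G :: 'a graph) vs adj (k::nat) (n::nat) (m::nat).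
       simple_graph G \<longrightarrow> adjacency_arrays G vs adj \<longrightarrow>
       n = card (verts G) \<longrightarrow> m = card (edges G) \<longrightarrow> n \<ge> 2 \<longrightarrow>
       k \<ge> 1 \<longrightarrow> real k \<le> a * log 2 (real n) ^ c \<longrightarrow>
         map_pmf run_output (stages_c vs adj k) = stages G k \<and>
         measure_pmf.prob (stages_c vs adj k)
           {r. culled_balanced_partition B b K G k (run_output r) \<and>
               real (work r) \<le> W * (real n + real m)} \<ge> 1 - real n powr (- d) \<and>
         (\<forall>r \<in> set_pmf (stages_c vs adj k). real (cspan r) \<le> S * log 2 (real n) ^ s))"
proof -
  define a' where "a' = max a 1"
  have a': "a' \<ge> 1" "a \<le> a'" by (auto simp: a'_def)
  obtain M where M: "M \<ge> 1" "\<And>n::nat. n \<ge> 2 \<Longrightarrow> log 2 (real n) ^ c \<le> M * real n"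
    using log_power_le_linear[of c] by blast
  \<comment> \<open>Since \<open>n\<close> is at least 2, this makes \<open>a' * M\<close> at most
    \<open>n ^ p\<close>, hence \<open>k\<close> at most \<open>n ^ (p + 1)\<close>.\<close>
  obtain p :: nat where p: "a' * M < 2 ^ p"
    using real_arch_pow[of 2 "a' * M"] by auto
  \<comment> \<open>\<open>r^2\<close> is at least \<open>p + 2\<close>, so a failure probability of
    order \<open>1 / n\<close> remains after the union bound over at most \<open>n ^ (p + 1)\<close>
    buckets.\<close>
  define r :: real where "r = p + 2"
  define B where "B = 12 * a' ^ 4"
  define W where "W = 1000 + a' * M"
  define S where "S = 960 + 16 * a'"
  show ?thesis
  proof (rule exI[of _ B], rule exI[of _ "4 * c + 2"], rule exI[of _ "1 + r"], rule exI[of _ W],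
      rule exI[of _ S], rule exI[of _ "c + 2"], rule exI[of _ 1], intro conjI allI impI)
    show "(1::real) > 0" by simp
  next
    fix G :: "'a graph" and vs adj and k n m :: nat
    assume G: "simple_graph G" and adj: "adjacency_arrays G vs adj"
      and n_def: "n = card (verts G)" and m_def: "m = card (edges G)" and n: "n \<ge> 2"
      and k: "k \<ge> 1" and ka: "real k \<le> a * log 2 (real n) ^ c"
    define L where "L = log 2 (real n)"
    have L: "L \<ge> 1" unfolding L_def by (rule log_ge_1[OF n k])
    have kL: "real k \<le> a' * L ^ c"
    proof -
      have "a * L ^ c \<le> a' * L ^ c" using a' L by (intro mult_right_mono) auto
      then show ?thesis using ka by (simp add: L_def)
    qed
    have kn: "real k \<le> a' * M * n"
    proof -
      have "a' * L ^ c \<le> a' * (M * n)" using M(2)[OF n] a' by (intro mult_left_mono) (auto simp: L_def)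
      then show ?thesis using kL by (simp add: mult.assoc)
    qed
    \<comment> \<open>The rounded-up logarithm serves as depth bound; rounding costs at most a
      factor 2 because \<open>L\<close> is at least 1.\<close>
    define d where "d = nat \<lceil>L\<rceil>"
    have d: "n \<le> 2 ^ d" and dL: "real d \<le> 2 * L"
    proof -
      have "real n = 2 powr L" using n by (simp add: L_def)
      also have "\<dots> \<le> 2 powr real d" using L by (intro powr_mono) (auto simp: d_def)
      also have "\<dots> = real (2 ^ d)" by (simp add: powr_realpow)
      finally show "n \<le> 2 ^ d" by linarith
      have "real d < L + 1" unfolding d_def using L by (simp add: of_nat_nat) linarith
      then show "real d \<le> 2 * L" using L by linarith
    qed
    define Ca where "Ca = stage_I G k"
    define P where "P = Pi_pmf (verts G - Ca) 0 (\<lambda>_. pmf_of_set {..<k})"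
    let ?V = "\<lambda>\<omega>. map (\<lambda>i. {v \<in> verts G - Ca. \<omega> v = i}) [0..<k]"
    obtain run where run: "stages_c vs adj k = map_pmf run P" and props: "\<forall>\<omega>\<in>set_pmf P.
        run_output (run \<omega>) = (Ca, ?V \<omega>) \<and> work (run \<omega>) \<le> 400 * (n + m + 1) + 17 * n + k + 2 \<and>
        real (cspan (run \<omega>)) \<le> 80 * (real d + 2) * (log 2 n + 2) + 6 * real k + 2 + real d * (2 * real k + 2)"
      using stages_c_run[OF G adj k n_def n d, folded m_def, folded Ca_def, folded P_def]
      by (elim exE conjE) (rule that)
    note out = props[rule_format, THEN conjunct1]
      and wk = props[rule_format, THEN conjunct2, THEN conjunct1]
      and sp = props[rule_format, THEN conjunct2, THEN conjunct2]
    note S1 = stage_I_c_correct[OF G adj k n_def n d, folded Ca_def]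

    show "map_pmf run_output (stages_c vs adj k) = stages G k"
      unfolding run stages_def stage_II_def Ca_def[symmetric] P_def[symmetric] map_pmf_comp
      by (intro map_pmf_cong refl out)

    have card_Ca: "real (card Ca) \<le> B * log 2 n ^ (4 * c + 2)"
    proof -
      \<comment> \<open>Of the exponent \<open>4 * c + 2\<close>, \<open>4 * c\<close> comes from
        \<open>k ^ 4\<close>, one from the logarithm in the threshold and one from the number of
        phases.\<close>
      have "real (card Ca) \<le> 4 * (real k ^ 4 * L) * (2 * L + 1)"
        using S1(7) by (simp add: L_def)
      also have "\<dots> \<le> 4 * (real k ^ 4 * L) * (3 * L)"
        using L by (intro mult_left_mono) auto
      also have "\<dots> = 12 * (real k ^ 4) * L\<^sup>2" by (simp add: power2_eq_square)
      also have "\<dots> \<le> 12 * (a' * L ^ c) ^ 4 * L\<^sup>2"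
        using kL by (intro mult_left_mono mult_right_mono power_mono) auto
      also have "\<dots> = B * L ^ (4 * c + 2)"
        by (simp add: B_def power_mult_distrib power_add mult.commute flip: power_mult) (simp add: power2_eq_square)
      finally show ?thesis by (simp add: L_def)
    qed
    have work_le: "real (work (run \<omega>)) \<le> W * (real n + real m)" if "\<omega> \<in> set_pmf P" for \<omega>
    proof -
      have "real (work (run \<omega>)) \<le> real (400 * (n + m + 1) + 17 * n + k + 2)"
        using wk[OF that] by (rule of_nat_mono)
      also have "\<dots> = 417 * real n + 400 * real m + 402 + k" by simp
      also have "\<dots> \<le> 1000 * real n + 1000 * real m + a' * M * n"
        using kn n by simp
      also have "\<dots> \<le> W * (real n + real m)"
        using a' M by (simp add: W_def algebra_simps)
      finally show ?thesis .
    qed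
    let ?good = "{r'. culled_balanced_partition B (4 * c + 2) (1 + r) G k (run_output r') \<and>
               real (work r') \<le> W * (real n + real m)}"
    let ?bad = "{\<omega>. \<not> culled_balanced_partition B (4 * c + 2) (1 + r) G k (Ca, ?V \<omega>)}"
    have "measure_pmf.prob P ?bad \<le> k * real n powr - r\<^sup>2"
      unfolding P_def using S1 card_Ca
      by (intro buckets_balanced G k n_def n) (auto simp: r_def)
    also have "\<dots> \<le> real n powr (real p + 1) * real n powr - (real p + 2)"
    proof (intro mult_mono)
      have "a' * M \<le> real n ^ p"
        using p n power_mono[of 2 "real n" p] by linarith
      then have "a' * M * n \<le> real n ^ p * n" by (intro mult_right_mono) auto
      with kn have "real k \<le> real n ^ p * n" by linarith
      then have "real k \<le> real n ^ (p + 1)" by (simp add: mult.commute)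
      also have "\<dots> = real n powr (real p + 1)"
        using n by (subst powr_realpow[symmetric]) (auto simp: add.commute)
      finally show "real k \<le> real n powr (real p + 1)" .
      have "real p + 2 \<le> r\<^sup>2"
        by (simp add: r_def power2_eq_square algebra_simps)
      then show "real n powr - r\<^sup>2 \<le> real n powr - (real p + 2)"
        using n by (intro powr_mono) auto
    qed auto
    also have "\<dots> = real n powr - 1"
      by (simp flip: powr_add)
    finally have bad: "measure_pmf.prob P ?bad \<le> real n powr - 1" .
    have "1 - real n powr - 1 \<le> 1 - measure_pmf.prob P ?bad" using bad by simp
    also have "\<dots> = measure_pmf.prob P (- ?bad)"
      by (subst measure_pmf.prob_compl[symmetric]) (auto simp: Compl_eq_Diff_UNIV)
    \<comment> \<open>Output and work are as required for every \<open>\<omega>\<close> in the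
      support, so only imbalance can make a run bad.\<close>
    also have "\<dots> \<le> measure_pmf.prob P (run -` ?good)"
      using out work_le by (intro measure_pmf.finite_measure_mono_AE) (auto simp: AE_measure_pmf_iff)
    finally show "1 - real n powr - 1 \<le> measure_pmf.prob (stages_c vs adj k) ?good"
      by (simp add: run)

    show "\<forall>r\<in>set_pmf (stages_c vs adj k). real (cspan r) \<le> S * log 2 (real n) ^ (c + 2)"
    proof
      fix x assume "x \<in> set_pmf (stages_c vs adj k)"
      then obtain \<omega> where \<omega>: "\<omega> \<in> set_pmf P" "x = run \<omega>" by (auto simp: run)
      have k1: "real k \<ge> 1" using k by simp
      have "real (cspan x) \<le> 80 * (real d + 2) * (L + 2) + 6 * real k + 2 + real d * (2 * real k + 2)"
        using sp[OF \<omega>(1)] by (simp add: \<omega>(2) L_def)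
      also have "\<dots> \<le> 80 * (4 * L) * (3 * L) + (8 * (real k * L) + 2 * L * (4 * real k))"
      proof -
        have "80 * (real d + 2) * (L + 2) \<le> 80 * (4 * L) * (3 * L)"
          using dL L by (intro mult_mono) auto
        moreover have "6 * real k + 2 \<le> 8 * (real k * L)"
        proof -
          have "real k * 1 \<le> real k * L" using L by (intro mult_left_mono) auto
          then show ?thesis using k1 by linarith
        qed
        moreover have "real d * (2 * real k + 2) \<le> 2 * L * (4 * real k)"
          using dL L k1 by (intro mult_mono) auto
        ultimately show ?thesis by linarith
      qed
      also have "\<dots> = 960 * L\<^sup>2 + 16 * real k * L" by (simp add: power2_eq_square)
      also have "\<dots> \<le> 960 * L ^ (c + 2) + 16 * (a' * L ^ c) * L\<^sup>2"
      proof (intro add_mono mult_mono)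
        show "L\<^sup>2 \<le> L ^ (c + 2)" using L by (intro power_increasing) auto
        show "L \<le> L\<^sup>2" using L by (simp add: power2_eq_square)
      qed (use kL L a' in auto)
      also have "\<dots> = S * L ^ (c + 2)"
        by (simp add: S_def power_add algebra_simps) (simp add: power2_eq_square)
      finally show "real (cspan x) \<le> S * log 2 (real n) ^ (c + 2)" by (simp add: L_def)
    qed
  qed
qed

end
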